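(* Every element of $\mathrm{Sp}(n,1)$ is reversible; that is, for every $g\in \mathrm{Sp}(n,1)$ there exists $x\in \mathrm{Sp}(n,1)$ such that $g^{-1}=xgx^{-1}$.
   Context: Let $\mathbb{H}$ be the real quaternions and $n\ge 1$. $\mathrm{Sp}(n,1)=\{g\in \mathrm{GL}(n+1,\mathbb{H})\mid {}^{t}\bar g J g=J\}$, where $J=\mathrm{diag}(-1,1,\ldots,1)$ and $\bar{\cdot}$ is entrywise quaternionic conjugation; it is the group of right $\mathbb{H}$-linear maps of $\mathbb{H}^{n+1}$ preserving the Hermitian form $\Phi(z,w)=-\bar z_0w_0+\bar z_1w_1+\cdots+\bar z_nw_n$. An element $g$ of a group $G$ is reversible if $g^{-1}=xgx^{-1}$ for some $x\in G$. *)

theory Defs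
  imports "HOL-Algebra.Group" "Jordan_Normal_Form.Matrix"
begin

section \<open>The real quaternions\<close>

codatatype quat = Quat (qRe: real) (qI: real) (qJ: real) (qK: real)

lemma quat_eq_iff: "p = q \<longleftrightarrow> qRe p = qRe q \<and> qI p = qI q \<and> qJ p = qJ q \<and> qK p = qK q"
  by (auto intro: quat.expand)

instantiation quat :: ab_group_add
begin

primcorec zero_quat where
  "qRe 0 = 0" | "qI 0 = 0" | "qJ 0 = 0" | "qK 0 = 0"

primcorec plus_quat where
  "qRe (p + q) = qRe p + qRe q"
| "qI (p + q) = qI p + qI q"
| "qJ (p + q) = qJ p + qJ q"
| "qK (p + q) = qK p + qK q"

primcorec uminus_quat where
  "qRe (- p) = - qRe p"
| "qI (- p) = - qI p"
| "qJ (- p) = - qJ p"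
| "qK (- p) = - qK p"

primcorec minus_quat where
  "qRe (p - q) = qRe p - qRe q"
| "qI (p - q) = qI p - qI q"
| "qJ (p - q) = qJ p - qJ q"
| "qK (p - q) = qK p - qK q"

instance
  by standard (auto simp: quat_eq_iff)

end

definition qnorm2 :: "quat \<Rightarrow> real" where
  "qnorm2 q = (qRe q)\<^sup>2 + (qI q)\<^sup>2 + (qJ q)\<^sup>2 + (qK q)\<^sup>2"

lemma qnorm2_eq_0_iff [simp]: "qnorm2 q = 0 \<longleftrightarrow> q = 0"
proof
  assume *: "qnorm2 q = 0"
  have "0 \<le> (qRe q)\<^sup>2" "0 \<le> (qI q)\<^sup>2" "0 \<le> (qJ q)\<^sup>2" "0 \<le> (qK q)\<^sup>2" by simp_all
  with * have "(qRe q)\<^sup>2 = 0" "(qI q)\<^sup>2 = 0" "(qJ q)\<^sup>2 = 0" "(qK q)\<^sup>2 = 0"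
    unfolding qnorm2_def by linarith+
  then show "q = 0" by (simp add: quat_eq_iff)
qed (simp add: qnorm2_def)

instantiation quat :: division_ring
begin

primcorec one_quat where
  "qRe 1 = 1" | "qI 1 = 0" | "qJ 1 = 0" | "qK 1 = 0"

primcorec times_quat where
  "qRe (p * q) = qRe p * qRe q - qI p * qI q - qJ p * qJ q - qK p * qK q"
| "qI (p * q) = qRe p * qI q + qI p * qRe q + qJ p * qK q - qK p * qJ q"
| "qJ (p * q) = qRe p * qJ q - qI p * qK q + qJ p * qRe q + qK p * qI q"
| "qK (p * q) = qRe p * qK q + qI p * qJ q - qJ p * qI q + qK p * qRe q"

primcorec inverse_quat where
  "qRe (inverse q) = qRe q / qnorm2 q"
| "qI (inverse q) = - qI q / qnorm2 q"
| "qJ (inverse q) = - qJ q / qnorm2 q"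
| "qK (inverse q) = - qK q / qnorm2 q"

definition divide_quat :: "quat \<Rightarrow> quat \<Rightarrow> quat" where
  "divide_quat p q = p * inverse q"

instance
proof
  fix p q r :: quat
  show "p * q * r = p * (q * r)" "(p + q) * r = p * r + q * r" "p * (q + r) = p * q + p * r"
    "1 * p = p" "p * 1 = p"
    by (simp_all add: quat_eq_iff algebra_simps)
  show "(0::quat) \<noteq> 1" by (simp add: quat_eq_iff)
  show "inverse (0::quat) = 0" by (simp add: quat_eq_iff)
  show "p div q = p * inverse q" by (rule divide_quat_def)
next
  fix p :: quat
  assume "p \<noteq> 0"
  then have nz: "qnorm2 p \<noteq> 0" by simp
  have "qRe p * qRe p / qnorm2 p + qI p * qI p / qnorm2 p
      + qJ p * qJ p / qnorm2 p + qK p * qK p / qnorm2 p = qnorm2 p / qnorm2 p"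
    by (simp only: qnorm2_def power2_eq_square add_divide_distrib)
  with nz have *: "qRe p * qRe p / qnorm2 p + qI p * qI p / qnorm2 p
      + qJ p * qJ p / qnorm2 p + qK p * qK p / qnorm2 p = 1" by simp
  show "inverse p * p = 1" "p * inverse p = 1"
    using * by (simp_all add: quat_eq_iff algebra_simps)
qed

end

primcorec qcnj :: "quat \<Rightarrow> quat" where
  "qRe (qcnj q) = qRe q"
| "qI (qcnj q) = - qI q"
| "qJ (qcnj q) = - qJ q"
| "qK (qcnj q) = - qK q"

lemma qcnj_zero [simp]: "qcnj 0 = 0"
  and qcnj_one [simp]: "qcnj 1 = 1"
  and qcnj_qcnj [simp]: "qcnj (qcnj p) = p"
  and qcnj_add: "qcnj (p + q) = qcnj p + qcnj q"
  and qcnj_mult: "qcnj (p * q) = qcnj q * qcnj p"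
  by (simp_all add: quat_eq_iff algebra_simps)

lemma qcnj_sum: "qcnj (sum f A) = (\<Sum>x\<in>A. qcnj (f x))"
  by (induction A rule: infinite_finite_induct) (simp_all add: qcnj_add)


section \<open>The group \<open>Sp(n,1)\<close>\<close>

text \<open>
  Conjugate transpose. The library's \<open>mat_adjoint\<close> and \<open>conjugatable_ring\<close> do not apply:
  the latter requires conjugation to preserve the order of products, while \<open>qcnj\<close> reverses it.
\<close>

definition quat_adjoint :: "quat mat \<Rightarrow> quat mat" where
  "quat_adjoint A = transpose_mat (map_mat qcnj A)"

definition quat_J :: "nat \<Rightarrow> quat mat" where
  "quat_J n = mat_diag (n + 1) (\<lambda>i. if i = 0 then - 1 else 1)"

text \<open>
  Matrices act on column vectors from the left, i.e. by right \<open>H\<close>-linear maps; membership in the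
  general linear group means having a two-sided inverse matrix.
\<close>

abbreviation quat_mat_ring :: "nat \<Rightarrow> quat mat ring" where
  "quat_mat_ring m \<equiv> ring_mat TYPE(quat) m ()"

definition GL_quat :: "nat \<Rightarrow> quat mat monoid" where
  "GL_quat m = units_of (quat_mat_ring m)"

definition Sp_n_1 :: "nat \<Rightarrow> quat mat monoid" where
  "Sp_n_1 n = (GL_quat (n + 1))
     \<lparr>carrier := {g \<in> carrier (GL_quat (n + 1)). quat_adjoint g * quat_J n * g = quat_J n}\<rparr>"

definition reversible :: "('a, 'b) monoid_scheme \<Rightarrow> 'a \<Rightarrow> bool" where
  "reversible G g \<longleftrightarrow> (\<exists>x\<in>carrier G. inv\<^bsub>G\<^esub> g = x \<otimes>\<^bsub>G\<^esub> g \<otimes>\<^bsub>G\<^esub> inv\<^bsub>G\<^esub> x)"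


section \<open>\<open>Sp(n,1)\<close> is a group\<close>

lemma quat_adjoint_carrier [simp]:
  "A \<in> carrier_mat r c \<Longrightarrow> quat_adjoint A \<in> carrier_mat c r"
  by (simp add: quat_adjoint_def)

lemma quat_J_carrier [simp]: "quat_J n \<in> carrier_mat (n + 1) (n + 1)"
  by (simp add: quat_J_def)

lemma quat_adjoint_mult:
  assumes "A \<in> carrier_mat r m" "B \<in> carrier_mat m c"
  shows "quat_adjoint (A * B) = quat_adjoint B * quat_adjoint A"
  using assms
  by (intro eq_matI) (auto simp: quat_adjoint_def scalar_prod_def qcnj_sum qcnj_mult)

lemma quat_adjoint_one [simp]: "quat_adjoint (1\<^sub>m m) = 1\<^sub>m m"
  by (intro eq_matI) (auto simp: quat_adjoint_def)

lemma group_GL_quat: "group (GL_quat m)"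
proof -
  interpret semiring "quat_mat_ring m" by (rule semiring_mat)
  show ?thesis unfolding GL_quat_def by (rule units_group)
qed

lemma mult_GL_quat [simp]: "g \<otimes>\<^bsub>GL_quat m\<^esub> h = g * h"
  and one_GL_quat [simp]: "\<one>\<^bsub>GL_quat m\<^esub> = 1\<^sub>m m"
  by (simp_all add: GL_quat_def units_of_def ring_mat_def)

lemma carrier_GL_quat:
  "carrier (GL_quat m) = {g \<in> carrier_mat m m. \<exists>h\<in>carrier_mat m m. h * g = 1\<^sub>m m \<and> g * h = 1\<^sub>m m}"
  by (auto simp: GL_quat_def units_of_def Units_def ring_mat_def)

lemma subgroup_Sp_n_1: "subgroup (carrier (Sp_n_1 n)) (GL_quat (n + 1))"
proof -
  let ?G = "GL_quat (n + 1)" and ?J = "quat_J n" and ?m = "n + 1"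
  interpret group ?G by (rule group_GL_quat)
  have S: "carrier (Sp_n_1 n) = {g \<in> carrier ?G. quat_adjoint g * ?J * g = ?J}"
    by (simp add: Sp_n_1_def)
  have mat: "g \<in> carrier_mat ?m ?m" if "g \<in> carrier ?G" for g
    using that by (auto simp: carrier_GL_quat)
  have J: "?J \<in> carrier_mat ?m ?m" by (rule quat_J_carrier)
  show ?thesis
  proof (rule subgroupI)
    show "carrier (Sp_n_1 n) \<subseteq> carrier ?G" by (auto simp: S)
    have "\<one>\<^bsub>?G\<^esub> \<in> carrier (Sp_n_1 n)"
      unfolding S mem_Collect_eq using J by (intro conjI one_closed) (simp del: add_Suc_right)
    then show "carrier (Sp_n_1 n) \<noteq> {}" by blast
  next
    fix g h assume g: "g \<in> carrier (Sp_n_1 n)" and h: "h \<in> carrier (Sp_n_1 n)"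
    then have gG: "g \<in> carrier ?G" and hG: "h \<in> carrier ?G"
      and gJ: "quat_adjoint g * ?J * g = ?J" and hJ: "quat_adjoint h * ?J * h = ?J"
      by (auto simp: S)
    note [simp] = mat[OF gG] mat[OF hG] J
    note ga = quat_adjoint_carrier[OF mat[OF gG]] and ha = quat_adjoint_carrier[OF mat[OF hG]]
    have "quat_adjoint (g * h) * ?J * (g * h) = quat_adjoint h * quat_adjoint g * ?J * (g * h)"
      by (simp only: quat_adjoint_mult[OF mat[OF gG] mat[OF hG]])
    also have "\<dots> = quat_adjoint h * (quat_adjoint g * ?J * g) * h"
      using ga ha mat[OF gG] mat[OF hG] J
      by (smt (verit) assoc_mult_mat mult_carrier_mat)
    also have "\<dots> = ?J" by (simp only: gJ hJ)
    finally show "g \<otimes>\<^bsub>?G\<^esub> h \<in> carrier (Sp_n_1 n)"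
      using m_closed[OF gG hG] by (simp add: S)
  next
    fix g assume g: "g \<in> carrier (Sp_n_1 n)"
    then have gG: "g \<in> carrier ?G" and gJ: "quat_adjoint g * ?J * g = ?J" by (auto simp: S)
    define h where "h = inv\<^bsub>?G\<^esub> g"
    have hG: "h \<in> carrier ?G" unfolding h_def by (rule inv_closed[OF gG])
    have gh: "g * h = 1\<^sub>m ?m"
      using r_inv[OF gG] by (simp only: h_def mult_GL_quat one_GL_quat)
    note gm = mat[OF gG] and hm = mat[OF hG]
    note ga = quat_adjoint_carrier[OF gm] and ha = quat_adjoint_carrier[OF hm]
    have "quat_adjoint h * ?J * h = quat_adjoint h * (quat_adjoint g * ?J * g) * h"
      by (simp only: gJ)
    also have "\<dots> = (quat_adjoint h * quat_adjoint g) * ?J * (g * h)"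
      using ga ha gm hm J by (smt (verit) assoc_mult_mat mult_carrier_mat)
    also have "quat_adjoint h * quat_adjoint g = 1\<^sub>m ?m"
      using quat_adjoint_mult[OF gm hm] gh by simp
    also have "1\<^sub>m ?m * ?J * (g * h) = ?J" unfolding gh using J by (metis left_mult_one_mat right_mult_one_mat)
    finally show "inv\<^bsub>?G\<^esub> g \<in> carrier (Sp_n_1 n)"
      using hG by (simp add: S h_def)
  qed
qed

lemma group_Sp_n_1: "group (Sp_n_1 n)"
proof -
  interpret group "GL_quat (n + 1)" by (rule group_GL_quat)
  have "Sp_n_1 n = (GL_quat (n + 1))\<lparr>carrier := carrier (Sp_n_1 n)\<rparr>"
    by (simp add: Sp_n_1_def)
  then show ?thesis
    using subgroup.subgroup_is_group[OF subgroup_Sp_n_1 group_GL_quat] by metis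
qed

end

(*
  One constructs an isometry x with x^2 = -1 and g x g = x; the first identity makes x invertible.
  If g has an eigenvector v with nonzero norm, its eigenvalue l may be taken complex of modulus 1;
  put x v = v j and continue by induction in the orthogonal complement of v.  Otherwise every
  eigenvector is null, and the Lorentzian signature forces the space to be spanned by
    - v, w with g v = v l and g w = w m, |l| <> 1 (hyperbolic),
    - v, w with g v = v l and g w = w l + v b, |l| = 1, or
    - v, z, w with g v = v l, g z = z l + v and g w = w l - z l^2 + v s, |l| = 1 (parabolic),
  where v and w are null.  In these cases x is written down, using a unit quaternion k in j C that
  conjugates l and the remaining coefficient simultaneously.
*)

theory Submission
  imports Defs "HOL-Computational_Algebra.Fundamental_Theorem_Algebra" "HOL-Library.Function_Algebras"
begin

section \<open>Quaternions as pairs of complex numbers\<close>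

text \<open>Scalars act on the right, so replacing an eigenvector \<open>v\<close> by
  \<open>v \<star> a\<close> conjugates its eigenvalue by \<open>a\<close>. In particular j turns
  the eigenvalue \<open>l\<close> into \<open>cnj l\<close>, which is the inverse of
  \<open>l\<close> when the modulus is 1; this is where reversibility comes from. The obstacle is a
  null eigenvector \<open>v\<close>: it lies in its own orthogonal complement, so its line does not
  split off and the map must be built on the whole space at once. The signature keeps that space
  small, because orthogonally to \<open>v\<close> every vector off its line has positive square. In
  the parabolic cases one coefficient of \<open>g\<close> remains, restricted by the isometry
  condition; the units of j C form a circle, which is just enough freedom to choose one that
  conjugates this coefficient together with \<open>l\<close>.\<close>

definition quat_of_complex :: "complex \<Rightarrow> quat" where
  "quat_of_complex c = Quat (Re c) (Im c) 0 0"

definition quat_j :: quat where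
  "quat_j = Quat 0 0 1 0"

lemma quat_of_complex_0 [simp]: "quat_of_complex 0 = 0"
  and quat_of_complex_1 [simp]: "quat_of_complex 1 = 1"
  and quat_of_complex_add: "quat_of_complex (a + b) = quat_of_complex a + quat_of_complex b"
  and quat_of_complex_diff: "quat_of_complex (a - b) = quat_of_complex a - quat_of_complex b"
  and quat_of_complex_minus: "quat_of_complex (- a) = - quat_of_complex a"
  and quat_of_complex_mult: "quat_of_complex (a * b) = quat_of_complex a * quat_of_complex b"
  and qcnj_quat_of_complex [simp]: "qcnj (quat_of_complex a) = quat_of_complex (cnj a)"
  by (simp_all add: quat_of_complex_def quat_eq_iff)

lemma quat_of_complex_eq_iff [simp]: "quat_of_complex a = quat_of_complex b \<longleftrightarrow> a = b"
  by (auto simp: quat_of_complex_def quat_eq_iff complex_eq_iff)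

lemma quat_of_complex_eq_0_iff [simp]: "quat_of_complex a = 0 \<longleftrightarrow> a = 0"
  using quat_of_complex_eq_iff[of a 0] by simp

lemma quat_of_complex_commute: "quat_of_complex a * quat_of_complex b = quat_of_complex b * quat_of_complex a"
  by (metis mult.commute quat_of_complex_mult)

lemma quat_of_real_central:
  "quat_of_complex (complex_of_real r) * q = q * quat_of_complex (complex_of_real r)"
  by (simp add: quat_of_complex_def quat_eq_iff)

lemma quat_j_mult_quat_of_complex: "quat_j * quat_of_complex a = quat_of_complex (cnj a) * quat_j"
  by (simp add: quat_of_complex_def quat_j_def quat_eq_iff)

lemma quat_j_sq [simp]: "quat_j * quat_j = - 1"
  by (simp add: quat_j_def quat_eq_iff)

lemma qcnj_quat_j [simp]: "qcnj quat_j = - quat_j"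
  by (simp add: quat_j_def quat_eq_iff)

lemma qcnj_minus: "qcnj (- a) = - qcnj a"
  by (simp add: quat_eq_iff)

lemma qcnj_eq_0_iff [simp]: "qcnj a = 0 \<longleftrightarrow> a = 0"
  by (auto simp: quat_eq_iff)

lemma qcnj_mult_self: "qcnj q * q = quat_of_complex (complex_of_real (qnorm2 q))"
  by (simp add: quat_of_complex_def quat_eq_iff qnorm2_def power2_eq_square)

lemma qnorm2_nonneg: "0 \<le> qnorm2 q"
  by (simp add: qnorm2_def)

lemma qnorm2_quat_of_complex: "qnorm2 (quat_of_complex a) = (cmod a)\<^sup>2"
  by (simp add: qnorm2_def quat_of_complex_def cmod_power2)

lemma cnj_mult_self_eq_1: "cmod a = 1 \<Longrightarrow> cnj a * a = 1"
  by (metis complex_norm_square mult.commute of_real_1 one_power2)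

lemma cnj_mult_self_eq_1I:
  assumes "(cmod l)\<^sup>2 * a = a" "a \<noteq> 0"
  shows "cnj l * l = 1"
proof -
  from assms have "(cmod l)\<^sup>2 = 1\<^sup>2" by simp
  then have "cmod l = 1" by (rule power2_eq_imp_eq) simp_all
  then show ?thesis by (rule cnj_mult_self_eq_1)
qed

lemma quat_complex_decomp:
  obtains a b where "q = quat_of_complex a + quat_of_complex b * quat_j"
proof
  show "q = quat_of_complex (Complex (qRe q) (qI q)) + quat_of_complex (Complex (qJ q) (qK q)) * quat_j"
    by (simp add: quat_of_complex_def quat_j_def quat_eq_iff)
qed

text \<open>In H = C + C j the equation splits: right multiplication by \<open>m\<close> acts as
  \<open>m\<close> on C and as \<open>cnj m\<close> on C j, so the two components of
  \<open>s\<close> solve scalar equations with nonzero denominators \<open>m - l\<close> and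
  \<open>cnj m - l\<close>. Adding \<open>v \<star> s\<close> to an eigenvector modulo
  \<open>v\<close> then removes the coefficient \<open>t\<close>.\<close>

lemma quat_sylvester:
  assumes "l \<noteq> m" "l \<noteq> cnj m"
  shows "\<exists>s. t + quat_of_complex l * s = s * quat_of_complex m"
proof -
  obtain a b where t: "t = quat_of_complex a + quat_of_complex b * quat_j"
    by (rule quat_complex_decomp)
  define c d where "c = a / (m - l)" and "d = b / (cnj m - l)"
  have "a + l * c = c * m" "b + l * d = d * cnj m"
    using assms by (auto simp: c_def d_def field_simps)
  then have *: "quat_of_complex a + quat_of_complex l * quat_of_complex c = quat_of_complex c * quat_of_complex m"
    "quat_of_complex b + quat_of_complex l * quat_of_complex d = quat_of_complex d * quat_of_complex (cnj m)"
    by (simp_all flip: quat_of_complex_mult quat_of_complex_add)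
  let ?s = "quat_of_complex c + quat_of_complex d * quat_j"
  have "t + quat_of_complex l * ?s = (quat_of_complex a + quat_of_complex l * quat_of_complex c)
     + (quat_of_complex b + quat_of_complex l * quat_of_complex d) * quat_j"
    by (simp add: t algebra_simps)
  also have "\<dots> = ?s * quat_of_complex m"
    unfolding * by (simp add: distrib_right mult.assoc quat_j_mult_quat_of_complex)
  finally show ?thesis by blast
qed

text \<open>A real \<open>l\<close> is central. Otherwise a suitable \<open>s\<close> in C j cancels
  the C j part of \<open>t\<close>, and the complex remainder commutes with \<open>l\<close>. The
  condition \<open>qcnj s = - s\<close> makes a null vector stay null when \<open>s\<close> times
  its null partner is added to it.\<close>

lemma quat_sylvester_centralizer:
  "\<exists>s. qcnj s = - s \<and> (t + quat_of_complex l * s - s * quat_of_complex l) * quat_of_complex l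
       = quat_of_complex l * (t + quat_of_complex l * s - s * quat_of_complex l)"
proof (cases "cnj l = l")
  case True
  then have "l = complex_of_real (Re l)" by (simp add: complex_eq_iff)
  then show ?thesis
    by (intro exI[of _ 0]) (metis add.right_neutral add_0 diff_zero minus_zero mult_zero_left mult_zero_right
        qcnj_zero quat_of_real_central)
next
  case False
  obtain a b where t: "t = quat_of_complex a + quat_of_complex b * quat_j"
    by (rule quat_complex_decomp)
  define d where "d = b / (cnj l - l)"
  have "b + l * d - d * cnj l = 0"
    using False by (simp add: d_def field_simps)
  then have *: "quat_of_complex b + quat_of_complex l * quat_of_complex d - quat_of_complex d * quat_of_complex (cnj l) = 0"
    by (simp flip: quat_of_complex_mult quat_of_complex_add quat_of_complex_diff)
  let ?s = "quat_of_complex d * quat_j"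
  have "t + quat_of_complex l * ?s - ?s * quat_of_complex l = quat_of_complex a
     + (quat_of_complex b + quat_of_complex l * quat_of_complex d - quat_of_complex d * quat_of_complex (cnj l)) * quat_j"
    by (simp add: t algebra_simps quat_j_mult_quat_of_complex)
  then have e: "t + quat_of_complex l * ?s - ?s * quat_of_complex l = quat_of_complex a"
    unfolding * by simp
  have "qcnj ?s = - ?s"
    by (simp add: qcnj_mult quat_j_mult_quat_of_complex)
  then show ?thesis
    using e quat_of_complex_commute by metis
qed

text \<open>Every unit of j C conjugates the complex numbers; it conjugates \<open>r\<close> as well
  iff it is orthogonal to \<open>r\<close>. So \<open>d\<close> is the j, k part of \<open>r\<close>
  turned by a right angle and normalised. If that part vanishes, any unit of j C serves, and
  \<open>d = 1\<close> is chosen.\<close>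

lemma quat_conjugating_unit:
  obtains k where "k * r = qcnj r * k" "k * k = - 1" "qcnj k = - k"
    "\<And>c. k * quat_of_complex c = quat_of_complex (cnj c) * k"
proof -
  define n where "n = (qJ r)\<^sup>2 + (qK r)\<^sup>2"
  define d where "d = (if n = 0 then 1 else Complex (- qK r / sqrt n) (qJ r / sqrt n))"
  have n: "n \<ge> 0" by (simp add: n_def)
  have n0: "n = 0 \<Longrightarrow> qJ r = 0 \<and> qK r = 0"
    unfolding n_def by (metis sum_power2_eq_zero_iff)
  have d1: "Re d * Re d + Im d * Im d = 1"
  proof (cases "n = 0")
    case False
    with n have "(qK r)\<^sup>2 / n + (qJ r)\<^sup>2 / n = 1"
      by (metis add.commute add_divide_distrib divide_self n_def)
    then show ?thesis using False n
      by (simp add: d_def power2_eq_square)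
  qed (simp add: d_def)
  have orth: "Re d * qJ r + Im d * qK r = 0"
    by (simp add: d_def n0)
  define k where "k = Quat 0 0 (Re d) (Im d)"
  have "k * r = qcnj r * k" "k * k = - 1" "qcnj k = - k"
    "\<And>c. k * quat_of_complex c = quat_of_complex (cnj c) * k"
    using d1 orth by (simp_all add: k_def quat_eq_iff quat_of_complex_def algebra_simps)
  then show ?thesis by (rule that)
qed

section \<open>Isometries of a Lorentzian quaternionic space\<close>

text \<open>\<open>Phi\<close> may be degenerate on the whole type: in the application the vectors
  are functions on \<open>nat\<close> and the form sees finitely many coordinates. Nondegeneracy is
  therefore asked of subspaces.\<close>

locale quat_isometry =
  fixes sc :: "'v::ab_group_add \<Rightarrow> quat \<Rightarrow> 'v" (infixl "\<star>" 75)
    and Phi :: "'v \<Rightarrow> 'v \<Rightarrow> quat"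
    and g :: "'v \<Rightarrow> 'v"
  assumes sc_add_left: "(u + w) \<star> a = u \<star> a + w \<star> a"
    and sc_add_right: "u \<star> (a + b) = u \<star> a + u \<star> b"
    and sc_sc: "u \<star> a \<star> b = u \<star> (a * b)"
    and sc_1 [simp]: "u \<star> 1 = u"
    and Phi_add_right: "Phi u (w + w') = Phi u w + Phi u w'"
    and Phi_sc_right: "Phi u (w \<star> a) = Phi u w * a"
    and qcnj_Phi: "qcnj (Phi u w) = Phi w u"
    and g_add: "g (u + w) = g u + g w"
    and g_sc: "g (u \<star> a) = g u \<star> a"
    and Phi_g: "Phi (g u) (g w) = Phi u w"
begin

lemma sc_0_right [simp]: "u \<star> 0 = 0"
  using sc_add_right[of u 0 0] by simp

lemma sc_0_left [simp]: "0 \<star> a = 0"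
  using sc_add_left[of 0 0 a] by simp

lemma sc_minus_right: "u \<star> (- a) = - (u \<star> a)"
  using sc_add_right[of u a "- a"] by (simp add: eq_neg_iff_add_eq_0 add.commute)

lemma sc_minus_left: "(- u) \<star> a = - (u \<star> a)"
  using sc_add_left[of u "- u" a] by (simp add: eq_neg_iff_add_eq_0 add.commute)

lemma sc_diff_right: "u \<star> (a - b) = u \<star> a - u \<star> b"
  using sc_add_right[of u a "- b"] by (simp add: sc_minus_right)

lemma sc_diff_left: "(u - w) \<star> a = u \<star> a - w \<star> a"
  using sc_add_left[of u "- w" a] by (simp add: sc_minus_left)

lemma sc_eq_0_iff [simp]: "u \<star> a = 0 \<longleftrightarrow> u = 0 \<or> a = 0"
proof (cases "a = 0")
  case False
  then have "u \<star> a \<star> inverse a = u" by (simp add: sc_sc)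
  with False show ?thesis by (metis sc_0_left)
qed simp

lemma Phi_sc_left: "Phi (u \<star> a) w = qcnj a * Phi u w"
  by (metis Phi_sc_right qcnj_Phi qcnj_mult)

lemma Phi_add_left: "Phi (u + u') w = Phi u w + Phi u' w"
  by (metis Phi_add_right qcnj_Phi qcnj_add)

lemma Phi_0_right [simp]: "Phi u 0 = 0"
  using Phi_sc_right[of u 0 0] by simp

lemma Phi_0_left [simp]: "Phi 0 u = 0"
  using Phi_sc_left[of 0 0 u] by simp

lemma Phi_minus_right: "Phi u (- w) = - Phi u w"
  using Phi_add_right[of u w "- w"] by (simp add: eq_neg_iff_add_eq_0 add.commute)

lemma Phi_minus_left: "Phi (- u) w = - Phi u w"
  using Phi_add_left[of u "- u" w] by (simp add: eq_neg_iff_add_eq_0 add.commute)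

lemma Phi_diff_right: "Phi u (w - w') = Phi u w - Phi u w'"
  using Phi_add_right[of u w "- w'"] by (simp add: Phi_minus_right)

lemma Phi_diff_left: "Phi (u - u') w = Phi u w - Phi u' w"
  using Phi_add_left[of u "- u'" w] by (simp add: Phi_minus_left)

lemmas Phi_simps = Phi_add_right Phi_add_left Phi_minus_right Phi_minus_left Phi_diff_right
  Phi_diff_left Phi_sc_right Phi_sc_left

lemmas sc_simps = sc_add_left sc_add_right sc_diff_left sc_diff_right sc_minus_left sc_minus_right sc_sc

lemma g_0 [simp]: "g 0 = 0"
  using g_sc[of 0 0] by simp

lemma g_minus: "g (- u) = - g u"
  using g_add[of u "- u"] by (simp add: eq_neg_iff_add_eq_0 add.commute)

lemma g_diff: "g (u - w) = g u - g w"
  using g_add[of u "- w"] by (simp add: g_minus)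

lemmas g_simps = g_add g_diff g_minus g_sc

definition sq :: "'v \<Rightarrow> real" where
  "sq u = qRe (Phi u u)"

lemma Phi_self: "Phi u u = quat_of_complex (complex_of_real (sq u))"
  using qcnj_Phi[of u u] by (simp add: quat_eq_iff quat_of_complex_def sq_def)

lemma sq_sc: "sq (u \<star> a) = qnorm2 a * sq u"
proof -
  have "Phi (u \<star> a) (u \<star> a) = qcnj a * (Phi u u * a)"
    by (simp only: Phi_sc_left Phi_sc_right mult.assoc)
  also have "\<dots> = qcnj a * a * Phi u u"
    by (simp only: Phi_self quat_of_real_central mult.assoc)
  also have "\<dots> = quat_of_complex (complex_of_real (qnorm2 a * sq u))"
    by (simp add: Phi_self qcnj_mult_self quat_of_complex_mult)
  finally show ?thesis
    by (simp add: sq_def quat_of_complex_def)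
qed

lemma sq_add_orthogonal: "Phi u w = 0 \<Longrightarrow> sq (u + w) = sq u + sq w"
  using qcnj_Phi[of u w] by (simp add: sq_def Phi_simps)

lemma sq_g: "sq (g u) = sq u"
  by (simp add: sq_def Phi_g)

lemma Phi_eq_0_commute: "Phi u w = 0 \<longleftrightarrow> Phi w u = 0"
  by (metis qcnj_Phi qcnj_eq_0_iff)

section \<open>Quaternionic subspaces and reversing maps\<close>

definition hsubspace :: "'v set \<Rightarrow> bool" where
  "hsubspace X \<longleftrightarrow> 0 \<in> X \<and> (\<forall>u\<in>X. \<forall>w\<in>X. u + w \<in> X) \<and> (\<forall>u\<in>X. \<forall>a. u \<star> a \<in> X)"

lemma hsubspaceD:
  assumes "hsubspace X"
  shows "0 \<in> X" "\<And>u w. u \<in> X \<Longrightarrow> w \<in> X \<Longrightarrow> u + w \<in> X" "\<And>u a. u \<in> X \<Longrightarrow> u \<star> a \<in> X"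
    "\<And>u. u \<in> X \<Longrightarrow> - u \<in> X" "\<And>u w. u \<in> X \<Longrightarrow> w \<in> X \<Longrightarrow> u - w \<in> X"
proof -
  show *: "0 \<in> X" "\<And>u w. u \<in> X \<Longrightarrow> w \<in> X \<Longrightarrow> u + w \<in> X" "\<And>u a. u \<in> X \<Longrightarrow> u \<star> a \<in> X"
    using assms unfolding hsubspace_def by auto
  show m: "- u \<in> X" if "u \<in> X" for u
    using *(3)[OF that, of "- 1"] by (simp add: sc_minus_right)
  show "u - w \<in> X" if "u \<in> X" "w \<in> X" for u w
    using *(2)[OF that(1) m[OF that(2)]] by simp
qed

text \<open>The condition \<open>g x g = x\<close> says that \<open>x\<close> conjugates \<open>g\<close> to its inverse, without mentioning inverses.\<close>

definition reversing :: "'v set \<Rightarrow> ('v \<Rightarrow> 'v) \<Rightarrow> bool" where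
  "reversing X x \<longleftrightarrow>
     (\<forall>u\<in>X. \<forall>w\<in>X. x (u + w) = x u + x w \<and> Phi (x u) (x w) = Phi u w) \<and>
     (\<forall>u\<in>X. x u \<in> X \<and> x (x u) = - u \<and> g (x (g u)) = x u \<and> (\<forall>a. x (u \<star> a) = x u \<star> a))"

text \<open>All conditions in \<open>reversing\<close> are linear or sesquilinear, so a spanning
  triple decides them. The two-dimensional cases take \<open>z = 0\<close>.\<close>

lemma reversing_span3:
  assumes X: "hsubspace X" and mem: "v \<in> X" "z \<in> X" "w \<in> X"
    and span: "\<And>u. u \<in> X \<Longrightarrow> \<exists>a b c. u = v \<star> a + z \<star> b + w \<star> c"
    and add: "\<And>u u'. x (u + u') = x u + x u'" and scal: "\<And>u a. x (u \<star> a) = x u \<star> a"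
    and B: "\<And>b. b \<in> {v, z, w} \<Longrightarrow> x b \<in> X \<and> x (x b) = - b \<and> g (x (g b)) = x b"
    and iso: "\<And>b b'. b \<in> {v, z, w} \<Longrightarrow> b' \<in> {v, z, w} \<Longrightarrow> Phi (x b) (x b') = Phi b b'"
  shows "reversing X x"
  unfolding reversing_def
proof (intro conjI ballI allI)
  fix u assume "u \<in> X"
  then obtain a b c where u: "u = v \<star> a + z \<star> b + w \<star> c" using span by blast
  show "x u \<in> X" "x (x u) = - u" "g (x (g u)) = x u"
    using B[of v] B[of z] B[of w] hsubspaceD(2,3)[OF X]
    by (simp_all add: u add scal g_simps sc_simps)
  fix u' assume "u' \<in> X"
  then obtain a' b' c' where u': "u' = v \<star> a' + z \<star> b' + w \<star> c'" using span by blast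
  show "Phi (x u) (x u') = Phi u u'"
    by (simp add: u u' add scal Phi_simps iso)
qed (auto simp: add scal)

text \<open>The new map sends \<open>v\<close> to \<open>v \<star> quat_j\<close> and agrees with
  the given one on \<open>Z\<close>. On the line of \<open>v\<close> it works because l j l = l (cnj
  l) j = j.\<close>

lemma reversing_orthogonal_sum:
  assumes X: "hsubspace X" and Z: "hsubspace Z" "Z \<subseteq> X" and v: "v \<in> X"
    and x: "reversing Z x" and gv: "g v = v \<star> quat_of_complex l" and l: "cnj l * l = 1"
    and sv: "sq v \<noteq> 0" and gZ: "\<And>z. z \<in> Z \<Longrightarrow> g z \<in> Z" and vZ: "\<And>z. z \<in> Z \<longleftrightarrow> z \<in> X \<and> Phi v z = 0"
  shows "\<exists>x. reversing X x"
proof -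
  \<comment> \<open>\<open>n\<close> inverts \<open>Phi v v\<close>, so \<open>c u\<close> is the
    coordinate of \<open>u\<close> along \<open>v\<close> and \<open>r u\<close> is the orthogonal
    projection to \<open>Z\<close>.\<close>
  define n where "n = quat_of_complex (complex_of_real (inverse (sq v)))"
  define c where "c u = n * Phi v u" for u
  define r where "r u = u - v \<star> c u" for u
  define y where "y u = v \<star> (quat_j * c u) + x (r u)" for u
  have nv: "n * Phi v v = 1" "Phi v v * n = 1"
    using sv by (simp_all add: n_def Phi_self flip: quat_of_complex_mult of_real_mult)
  have c_add: "c (u + w) = c u + c w" and c_sc: "c (u \<star> a) = c u * a" for u w a
    by (simp_all add: c_def Phi_simps algebra_simps)
  have r_add: "r (u + w) = r u + r w" and r_sc: "r (u \<star> a) = r u \<star> a" for u w a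
    by (simp_all add: r_def c_add c_sc sc_simps)
  have rZ: "r u \<in> Z" if "u \<in> X" for u
  proof -
    have "Phi v (r u) = Phi v u - (Phi v v * n) * Phi v u" by (simp add: r_def c_def Phi_simps mult.assoc)
    then show ?thesis using that hsubspaceD[OF X] v unfolding vZ nv by (simp add: r_def)
  qed
  have c_v: "c (v \<star> a) = a" and r_v: "r (v \<star> a) = 0" for a
    by (simp_all add: c_def r_def Phi_simps nv flip: mult.assoc)
  have c_Z: "c z = 0" and r_Z: "r z = z" if "z \<in> Z" for z
    using that vZ by (simp_all add: c_def r_def)
  have dec: "u = v \<star> c u + r u" for u by (simp add: r_def)
  have y_dec: "y (v \<star> a + z) = v \<star> (quat_j * a) + x z" if "z \<in> Z" for a z
    using that by (simp add: y_def c_add r_add c_v r_v c_Z r_Z)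
  have xZ: "x z \<in> Z" "x (x z) = - z" "g (x (g z)) = x z" if "z \<in> Z" for z
    using that x by (auto simp: reversing_def)
  have j: "quat_j * (quat_j * a) = - a" for a by (simp flip: mult.assoc)
  have jl: "quat_of_complex l * (quat_j * (quat_of_complex l * a)) = quat_j * a" for a
  proof -
    have "quat_of_complex l * (quat_j * (quat_of_complex l * a)) = quat_of_complex l * quat_of_complex (cnj l) * (quat_j * a)"
      by (metis mult.assoc quat_j_mult_quat_of_complex)
    then show ?thesis using l by (simp add: mult.commute flip: quat_of_complex_mult)
  qed
  have "reversing X y"
    unfolding reversing_def
  proof (intro conjI ballI allI)
    fix u assume u: "u \<in> X"
    note ru = rZ[OF u]
    show "y u \<in> X"
      using u v Z(2) xZ(1)[OF ru] hsubspaceD(2,3)[OF X] by (auto simp: y_def)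
    have "y (y u) = v \<star> (quat_j * (quat_j * c u)) + x (x (r u))"
      unfolding y_def[of u] by (rule y_dec) (rule xZ(1)[OF ru])
    also have "\<dots> = - (v \<star> c u + r u)" by (simp add: j xZ(2)[OF ru] sc_minus_right)
    also have "\<dots> = - u" using dec[of u] by simp
    finally show "y (y u) = - u" .
    have "g u = v \<star> (quat_of_complex l * c u) + g (r u)"
      using arg_cong[OF dec[of u], of g] by (simp add: g_simps gv sc_sc)
    then have "y (g u) = v \<star> (quat_j * (quat_of_complex l * c u)) + x (g (r u))"
      using y_dec[OF gZ[OF ru]] by simp
    then show "g (y (g u)) = y u"
      by (simp add: g_simps gv sc_sc xZ(3)[OF ru] jl y_def)
    show "y (u \<star> a) = y u \<star> a" for a
      using x ru by (simp add: y_def c_sc r_sc reversing_def sc_simps mult.assoc)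
    fix w assume w: "w \<in> X"
    note rw = rZ[OF w]
    show "y (u + w) = y u + y w"
      using x ru rw by (simp add: y_def c_add r_add reversing_def sc_simps algebra_simps)
    have z0: "Phi v z = 0" "Phi z v = 0" if "z \<in> Z" for z
      using that vZ Phi_eq_0_commute by blast+
    have "Phi (y u) (y w) = qcnj (quat_j * c u) * Phi v v * (quat_j * c w) + Phi (x (r u)) (x (r w))"
      using z0[OF xZ(1)[OF ru]] z0[OF xZ(1)[OF rw]] by (simp add: y_def Phi_simps mult.assoc)
    \<comment> \<open>\<open>Phi v v\<close> is real, hence central, so the factors - j and j meet
      and cancel.\<close>
    also have "qcnj (quat_j * c u) * Phi v v * (quat_j * c w) = qcnj (c u) * Phi v v * c w"
      by (simp add: qcnj_mult Phi_self mult.assoc j) (metis (no_types) j mult.assoc quat_of_real_central minus_mult_right minus_minus)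
    also have "Phi (x (r u)) (x (r w)) = Phi (r u) (r w)"
      using x ru rw by (simp add: reversing_def)
    also have "qcnj (c u) * Phi v v * c w + Phi (r u) (r w) = Phi (v \<star> c u + r u) (v \<star> c w + r w)"
      using z0[OF ru] z0[OF rw] by (simp add: Phi_simps mult.assoc)
    also have "\<dots> = Phi u w" using dec by metis
    finally show "Phi (y u) (y w) = Phi u w" .
  qed
  then show ?thesis by blast
qed

section \<open>Complex structure and dimension\<close>

sublocale cs: vector_space "\<lambda>c u. u \<star> quat_of_complex c"
  by unfold_locales
    (simp_all add: sc_simps quat_of_complex_add quat_of_complex_mult quat_of_complex_commute)

text \<open>Bounding independent sets passes to subsets at once and needs no basis of
  \<open>X\<close>. Finiteness is demanded separately because an infinite set has
  \<open>card\<close> 0.\<close>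

definition cdim_le :: "nat \<Rightarrow> 'v set \<Rightarrow> bool" where
  "cdim_le k X \<longleftrightarrow> (\<forall>S\<subseteq>X. cs.independent S \<longrightarrow> finite S \<and> card S \<le> k)"

lemma cdim_le_mono: "cdim_le k X \<Longrightarrow> Y \<subseteq> X \<Longrightarrow> cdim_le k Y"
  by (auto simp: cdim_le_def)

text \<open>An independent subset of \<open>Z\<close> stays independent when \<open>v\<close> joins
  it. This is the descent step of the induction on dimension.\<close>

lemma cdim_le_proper_subspace:
  assumes "cdim_le k X" "hsubspace Z" "Z \<subseteq> X" "v \<in> X" "v \<notin> Z"
  shows "k > 0" "cdim_le (k - 1) Z"
proof -
  have sub: "cs.subspace Z"
    using hsubspaceD[OF assms(2)] by (auto simp: cs.subspace_def)
  have *: "finite S \<and> Suc (card S) \<le> k" if S: "S \<subseteq> Z" "cs.independent S" for S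
  proof -
    have "cs.span S \<subseteq> Z" using cs.span_minimal[OF S(1) sub] .
    with assms(5) have "cs.independent (insert v S)" "v \<notin> S"
      using cs.independent_insertI[OF _ S(2)] cs.span_superset[of S] by auto
    moreover have "insert v S \<subseteq> X" using S assms by auto
    ultimately have "finite (insert v S) \<and> card (insert v S) \<le> k"
      using assms(1) unfolding cdim_le_def by metis
    with \<open>v \<notin> S\<close> show ?thesis by (auto simp: card_insert_disjoint)
  qed
  from *[of "{}"] show "k > 0" by (simp add: cs.independent_empty)
  show "cdim_le (k - 1) Z"
    unfolding cdim_le_def
  proof (intro allI impI)
    fix S assume "S \<subseteq> Z" "cs.independent S"
    then have "finite S \<and> Suc (card S) \<le> k" by (rule *)
    then show "finite S \<and> card S \<le> k - 1" by auto
  qed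
qed

lemma cdim_le_span:
  assumes "finite B" "X \<subseteq> cs.span B"
  shows "cdim_le (card B) X"
  using cs.independent_span_bound[OF assms(1)] assms(2) unfolding cdim_le_def by blast

lemma sc_in_span: "u \<star> a \<in> cs.span {u, u \<star> quat_j}"
proof -
  obtain b c where a: "a = quat_of_complex b + quat_of_complex c * quat_j"
    by (rule quat_complex_decomp)
  have "u \<star> a = u \<star> quat_of_complex b + u \<star> quat_j \<star> quat_of_complex (cnj c)"
    by (simp add: a sc_simps quat_j_mult_quat_of_complex)
  then show ?thesis
    by (simp only:) (intro cs.span_add cs.span_scale cs.span_base; simp)
qed

section \<open>Eigenvectors modulo a subspace\<close>

text \<open>The polynomial \<open>p\<close> in the complex linear map \<open>g\<close>, applied to
  \<open>u\<close> in Horner form. The fold builds functions of the vector because the tail is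
  evaluated at \<open>g u\<close>.\<close>

definition poly_act :: "complex poly \<Rightarrow> 'v \<Rightarrow> 'v" where
  "poly_act p = fold_coeffs (\<lambda>a f u. u \<star> quat_of_complex a + f (g u)) p (\<lambda>_. 0)"

lemma poly_act_0 [simp]: "poly_act 0 u = 0"
  by (simp add: poly_act_def)

lemma poly_act_pCons [simp]:
  "poly_act (pCons a p) u = u \<star> quat_of_complex a + poly_act p (g u)"
  by (cases "p = 0 \<and> a = 0") (auto simp: poly_act_def)

lemma poly_act_add: "poly_act (p + q) u = poly_act p u + poly_act q u"
  by (induction p q arbitrary: u rule: poly_induct2)
    (simp_all add: sc_simps quat_of_complex_add algebra_simps)

lemma poly_act_smult: "poly_act (smult c p) u = poly_act p (u \<star> quat_of_complex c)"
  by (induction p arbitrary: u)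
    (simp_all add: sc_simps g_simps flip: quat_of_complex_mult)

lemma poly_act_add_right: "poly_act p (u + w) = poly_act p u + poly_act p w"
  by (induction p arbitrary: u w) (simp_all add: sc_simps g_simps algebra_simps)

lemma poly_act_linear_factor:
  "poly_act ([:- m, 1:] * q) u = poly_act q (g u - u \<star> quat_of_complex m)"
proof -
  have "[:- m, 1:] * q = pCons 0 q + smult (- m) q" by simp
  then have "poly_act ([:- m, 1:] * q) u = poly_act q (g u) + poly_act q (u \<star> quat_of_complex (- m))"
    by (simp only: poly_act_add poly_act_smult) simp
  also have "\<dots> = poly_act q (g u - u \<star> quat_of_complex m)"
    by (simp add: quat_of_complex_minus sc_minus_right flip: poly_act_add_right)
  finally show ?thesis .
qed

lemma poly_act_monom: "poly_act (monom c i) u = (g ^^ i) u \<star> quat_of_complex c"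
  by (induction i arbitrary: u) (simp_all add: monom_0 monom_Suc funpow_swap1)

lemma poly_act_sum: "poly_act (sum f A) u = (\<Sum>i\<in>A. poly_act (f i) u)"
  by (induction A rule: infinite_finite_induct) (simp_all add: poly_act_add)

text \<open>Among the \<open>k + 1\<close> iterates from \<open>u\<close> to
  \<open>(g ^^ k) u\<close> either two coincide, which gives a difference of two monomials, or there
  is a complex linear relation, whose coefficients form the polynomial.\<close>

lemma annihilating_poly:
  assumes inv: "\<And>u. u \<in> X \<Longrightarrow> g u \<in> X" and dim: "cdim_le k X" and u: "u \<in> X"
  shows "\<exists>p. p \<noteq> 0 \<and> poly_act p u = 0"
proof -
  define f where "f i = (g ^^ i) u" for i
  have fX: "f i \<in> X" for i
    unfolding f_def by (induction i) (simp_all add: u inv)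
  show ?thesis
  proof (cases "inj_on f {..k}")
    case True
    then have "card (f ` {..k}) = Suc k" by (simp add: card_image)
    then have "cs.dependent (f ` {..k})"
      using dim fX unfolding cdim_le_def by (metis Suc_n_not_le_n image_subsetI)
    then obtain c where c: "\<exists>w\<in>f ` {..k}. c w \<noteq> 0" "(\<Sum>w\<in>f ` {..k}. w \<star> quat_of_complex (c w)) = 0"
      unfolding cs.dependent_finite[OF finite_imageI[OF finite_atMost]] by blast
    define p where "p = (\<Sum>i\<le>k. monom (c (f i)) i)"
    have "poly_act p u = (\<Sum>i\<le>k. f i \<star> quat_of_complex (c (f i)))"
      by (simp add: p_def poly_act_sum poly_act_monom f_def)
    also have "\<dots> = 0" using c(2) by (simp add: sum.reindex[OF True])
    finally have "poly_act p u = 0" .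
    moreover from c(1) obtain i where "i \<le> k" "c (f i) \<noteq> 0" by auto
    then have "coeff p i \<noteq> 0" by (simp add: p_def coeff_sum)
    then have "p \<noteq> 0" by auto
    ultimately show ?thesis by blast
  next
    case False
    then obtain i j where ij: "i \<noteq> j" "f i = f j" by (auto simp: inj_on_def)
    let ?p = "monom 1 i + monom (- 1) j :: complex poly"
    have "poly_act ?p u = 0"
      using ij(2) by (simp add: poly_act_add poly_act_monom quat_of_complex_minus sc_minus_right f_def)
    moreover have "coeff ?p i \<noteq> 0" using ij(1) by simp
    then have "?p \<noteq> 0" by (metis coeff_0)
    ultimately show ?thesis by blast
  qed
qed

text \<open>Let \<open>m\<close> be a root of \<open>p\<close>. If \<open>g u - u m\<close> lies in
  \<open>Q\<close>, then \<open>u\<close> is the required vector; otherwise \<open>g u - u m\<close>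
  is a vector outside \<open>Q\<close> that a polynomial of smaller degree still sends into
  \<open>Q\<close>.\<close>

lemma quotient_eigenvector_poly:
  assumes X: "hsubspace X" "\<And>u. u \<in> X \<Longrightarrow> g u \<in> X" and Q: "hsubspace Q"
  shows "p \<noteq> 0 \<Longrightarrow> poly_act p u \<in> Q \<Longrightarrow> u \<in> X - Q \<Longrightarrow>
    \<exists>z\<in>X - Q. \<exists>m. g z - z \<star> quat_of_complex m \<in> Q"
proof (induction "degree p" arbitrary: p u)
  case 0
  then obtain a where p: "p = [:a:]" "a \<noteq> 0" by (metis degree_eq_zeroE pCons_0_0)
  with 0 have "u \<star> quat_of_complex a \<in> Q" by simp
  then have "u \<star> quat_of_complex a \<star> quat_of_complex (inverse a) \<in> Q"
    by (rule hsubspaceD(3)[OF Q])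
  with p have "u \<in> Q" by (simp add: sc_sc flip: quat_of_complex_mult)
  with 0 show ?case by simp
next
  case (Suc d)
  have "\<not> constant (poly p)"
    using Suc(2) by (simp add: constant_degree)
  then obtain m where "poly p m = 0" using fundamental_theorem_of_algebra by blast
  then obtain q where q: "p = [:- m, 1:] * q" by (metis dvdE poly_eq_0_iff_dvd)
  with Suc(3) have q0: "q \<noteq> 0" by auto
  with Suc(2) q have "d = degree q" by (simp add: degree_mult_eq del: mult_pCons_left)
  let ?u = "g u - u \<star> quat_of_complex m"
  show ?case
  proof (cases "?u \<in> Q")
    case False
    then have "?u \<in> X - Q" using Suc(5) hsubspaceD(3,5)[OF X(1)] X(2) by auto
    moreover have "poly_act q ?u \<in> Q"
      using Suc(4) unfolding q poly_act_linear_factor .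
    ultimately show ?thesis using Suc(1)[OF \<open>d = degree q\<close> q0] by blast
  qed (use Suc(5) in blast)
qed

text \<open>Used with \<open>Q = {0}\<close> for a genuine eigenvector and with \<open>Q\<close> the
  line of a null eigenvector for a candidate Jordan vector above it.\<close>

lemma quotient_eigenvector:
  assumes "hsubspace X" "\<And>u. u \<in> X \<Longrightarrow> g u \<in> X" "cdim_le k X" "hsubspace Q" "\<not> X \<subseteq> Q"
  obtains z m where "z \<in> X" "z \<notin> Q" "g z - z \<star> quat_of_complex m \<in> Q"
proof -
  obtain u where u: "u \<in> X - Q" using assms(5) by blast
  obtain p where "p \<noteq> 0" "poly_act p u = 0"
    using annihilating_poly[OF assms(2,3)] u by blast
  then show ?thesis
    using quotient_eigenvector_poly[OF assms(1,2,4), of p u] u hsubspaceD(1)[OF assms(4)] that by auto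
qed

section \<open>Eigenvectors, orthogonal complements and null pairs\<close>

lemma eigenvalue_norm_1:
  assumes "g v = v \<star> quat_of_complex l" "sq v \<noteq> 0"
  shows "cnj l * l = 1"
  using sq_g[of v] assms by (intro cnj_mult_self_eq_1I[of l "sq v"]) (simp_all add: sq_sc qnorm2_quat_of_complex)

lemma hsubspace_range_sc: "hsubspace (range (\<lambda>a. v \<star> a))"
proof -
  have "v \<star> a + v \<star> b \<in> range (\<lambda>a. v \<star> a)" "v \<star> a \<star> b \<in> range (\<lambda>a. v \<star> a)"
    "0 \<in> range (\<lambda>a. v \<star> a)" for a b
    using sc_add_right[of v a b] sc_sc[of v a b] sc_0_right[of v] by (metis rangeI)+
  then show ?thesis by (auto simp: hsubspace_def)
qed

lemma hsubspace_perp: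
  assumes "hsubspace X"
  shows "hsubspace {u \<in> X. Phi v u = 0}"
  using hsubspaceD[OF assms] unfolding hsubspace_def by (auto simp: Phi_simps)

lemma Phi_eigenvector_g:
  assumes "g v = v \<star> quat_of_complex l"
  shows "quat_of_complex (cnj l) * Phi v (g u) = Phi v u"
  using Phi_g[of v u] by (simp add: assms Phi_simps)

text \<open>A vector pairing nontrivially with \<open>v\<close> is rescaled, made orthogonal to
  \<open>z\<close>, and moved along \<open>v\<close> until it is null. A unit \<open>z\<close>
  serves the three-dimensional parabolic case, \<open>z = 0\<close> the others.\<close>

lemma null_partner:
  assumes X: "hsubspace X" and nondeg: "\<And>u. u \<in> X \<Longrightarrow> (\<And>w. w \<in> X \<Longrightarrow> Phi u w = 0) \<Longrightarrow> u = 0"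
    and v: "v \<in> X" "v \<noteq> 0" "Phi v v = 0" and z: "z \<in> X" "Phi v z = 0" "z = 0 \<or> Phi z z = 1"
  obtains w where "w \<in> X" "Phi v w = 1" "Phi z w = 0" "Phi w w = 0"
proof -
  obtain y where y: "y \<in> X" "Phi v y \<noteq> 0" using nondeg[OF v(1)] v(2) by blast
  define y1 where "y1 = y \<star> inverse (Phi v y)"
  have y1: "y1 \<in> X" "Phi v y1 = 1" using y hsubspaceD(3)[OF X] by (simp_all add: y1_def Phi_simps)
  define y2 where "y2 = y1 - z \<star> Phi z y1"
  have y2: "y2 \<in> X" "Phi v y2 = 1" "Phi z y2 = 0"
    using y1 z hsubspaceD(3,5)[OF X] by (auto simp: y2_def Phi_simps)
  have zv: "Phi z v = 0" and y2v: "Phi y2 v = 1"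
    using z(2) y2(2) qcnj_Phi[of v z] qcnj_Phi[of v y2] by simp_all
  \<comment> \<open>Subtracting \<open>v \<star> r\<close> with \<open>r\<close> real lowers the
    square by twice \<open>r\<close>, hence the half.\<close>
  define r where "r = quat_of_complex (complex_of_real (sq y2 / 2))"
  have r: "qcnj r = r" "r + r = Phi y2 y2" by (simp_all add: r_def Phi_self flip: quat_of_complex_add)
  have "Phi (y2 - v \<star> r) (y2 - v \<star> r) = Phi y2 y2 - r - r"
    by (simp add: Phi_simps v(3) y2(2) y2v r(1))
  also have "\<dots> = 0" using r(2) by (metis add_diff_cancel_right' diff_self)
  finally have "Phi (y2 - v \<star> r) (y2 - v \<star> r) = 0" .
  moreover have "y2 - v \<star> r \<in> X" using y2 v hsubspaceD(3,5)[OF X] by blast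
  ultimately show ?thesis
    by (intro that[of "y2 - v \<star> r"]) (simp_all add: Phi_simps v(3) y2 zv)
qed

end

text \<open>Excludes nonpositive subspaces of dimension two; in particular, orthogonally to a
  nonzero null vector everything off its line has positive square. The condition is inherited by
  subspaces, so \<open>V\<close> stays fixed while the induction shrinks the space.\<close>

locale lorentz_isometry = quat_isometry +
  fixes V :: "'a set"
  assumes lorentz: "\<lbrakk>u \<in> V; w \<in> V; u \<noteq> 0; sq u \<le> 0; sq w \<le> 0; Phi u w = 0\<rbrakk> \<Longrightarrow> w \<in> range (\<lambda>a. u \<star> a)"
begin

text \<open>
  An eigenvector \<open>z\<close> modulo \<open>v\<close> whose eigenvalue is not conjugate to \<open>l\<close> could be corrected by a
  multiple of \<open>v\<close> to a genuine eigenvector, which is not null.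
\<close>

lemma null_eigenvector_jordan_partner:
  assumes U: "hsubspace U" "\<And>u. u \<in> U \<Longrightarrow> g u \<in> U" "U \<subseteq> V" "cdim_le k U"
    and v: "v \<in> U" "v \<noteq> 0" "Phi v v = 0" "\<And>u. u \<in> U \<Longrightarrow> Phi v u = 0" "g v = v \<star> quat_of_complex l"
    and null: "\<And>u m. u \<in> U \<Longrightarrow> g u = u \<star> quat_of_complex m \<Longrightarrow> sq u = 0"
    and U_ne: "\<not> U \<subseteq> range (\<lambda>a. v \<star> a)"
  shows "\<exists>z t. z \<in> U \<and> z \<notin> range (\<lambda>a. v \<star> a) \<and> g z = z \<star> quat_of_complex l + v \<star> t \<and>
    t * quat_of_complex l = quat_of_complex l * t"
proof -
  let ?Q = "range (\<lambda>a. v \<star> a)"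
  note Q = hsubspaceD[OF hsubspace_range_sc[of v]] and U' = hsubspaceD[OF U(1)]
  have vQ: "v \<star> s \<in> ?Q" for s by simp
  obtain z m where z: "z \<in> U" "z \<notin> ?Q" "g z - z \<star> quat_of_complex m \<in> ?Q"
    using quotient_eigenvector[OF U(1,2,4) hsubspace_range_sc U_ne] by metis
  from z(3) obtain t where "g z - z \<star> quat_of_complex m = v \<star> t" by blast
  then have gz: "g z = z \<star> quat_of_complex m + v \<star> t" by (simp add: algebra_simps)
  have "m = l \<or> m = cnj l"
  proof (rule ccontr)
    assume "\<not> ?thesis"
    then have "l \<noteq> m" "l \<noteq> cnj m" by auto
    then obtain s where s: "t + quat_of_complex l * s = s * quat_of_complex m"
      using quat_sylvester by blast
    let ?e = "z + v \<star> s"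
    have "g ?e = z \<star> quat_of_complex m + v \<star> (t + quat_of_complex l * s)"
      by (simp add: g_simps gz v(5) sc_simps algebra_simps)
    also have "\<dots> = ?e \<star> quat_of_complex m" by (simp add: s sc_simps)
    finally have "g ?e = ?e \<star> quat_of_complex m" .
    moreover have e: "?e \<in> U" using z v U' by blast
    ultimately have "sq ?e = 0" using null by blast
    \<comment> \<open>\<open>?e\<close> is null and orthogonal to the null vector \<open>v\<close>,
      so the signature puts it on the line of \<open>v\<close>, and \<open>z\<close> with
      it.\<close>
    then have "?e \<in> ?Q"
      using e v U(3) by (intro lorentz) (auto simp: sq_def)
    then have "?e - v \<star> s \<in> ?Q" using Q(5) vQ by blast
    with z(2) show False by simp
  qed
  then have "\<exists>z t. z \<in> U \<and> z \<notin> ?Q \<and> g z = z \<star> quat_of_complex l + v \<star> t"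
  proof
    \<comment> \<open>Right multiplication of \<open>z\<close> by j conjugates its
      eigenvalue.\<close>
    assume "m = cnj l"
    with gz have "g (z \<star> quat_j) = z \<star> quat_j \<star> quat_of_complex l + v \<star> (t * quat_j)"
      by (simp add: g_simps sc_simps quat_j_mult_quat_of_complex)
    moreover have "z \<star> quat_j \<in> U" using z U' by blast
    moreover have "z \<star> quat_j \<notin> ?Q"
    proof
      assume "z \<star> quat_j \<in> ?Q"
      then have "z \<star> quat_j \<star> (- quat_j) \<in> ?Q" by (rule Q(3))
      with z(2) show False by (simp add: sc_sc)
    qed
    ultimately show ?thesis by blast
  qed (use z gz in blast)
  then obtain z t where z: "z \<in> U" "z \<notin> ?Q" and gz: "g z = z \<star> quat_of_complex l + v \<star> t" by blast
  \<comment> \<open>Adding \<open>v \<star> s\<close> to \<open>z\<close> changes \<open>t\<close>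
    by the commutator of \<open>l\<close> and \<open>s\<close>.\<close>
  obtain s where s: "(t + quat_of_complex l * s - s * quat_of_complex l) * quat_of_complex l
       = quat_of_complex l * (t + quat_of_complex l * s - s * quat_of_complex l)"
    using quat_sylvester_centralizer by blast
  show ?thesis
  proof (intro exI conjI)
    show "z + v \<star> s \<in> U" using z v U' by blast
    show "z + v \<star> s \<notin> ?Q"
    proof
      assume "z + v \<star> s \<in> ?Q"
      then have "z + v \<star> s - v \<star> s \<in> ?Q" using Q(5) vQ by blast
      with z(2) show False by simp
    qed
    show "g (z + v \<star> s) = (z + v \<star> s) \<star> quat_of_complex l
        + v \<star> (t + quat_of_complex l * s - s * quat_of_complex l)"
      by (simp add: g_simps gz v(5) sc_simps algebra_simps)
  qed (rule s)
qed

section \<open>Reversing maps in explicit bases\<close>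

text \<open>The two null lines have to be exchanged, since the eigenvalues on them are not of
  modulus 1 in general but satisfy m (cnj l) = 1. With the factor j this gives m j l = m (cnj l) j =
  j.\<close>

lemma reversing_hyperbolic:
  assumes X: "hsubspace X" and v: "v \<in> X" "Phi v v = 0" "g v = v \<star> quat_of_complex l"
    and w: "w \<in> X" "Phi w w = 0" "Phi v w = 1" "g w = w \<star> quat_of_complex m"
    and lm: "cnj l * m = 1"
    and span: "\<And>u. u \<in> X \<Longrightarrow> \<exists>a b. u = v \<star> a + w \<star> b"
  shows "\<exists>x. reversing X x"
proof -
  have wv: "Phi w v = 1" using qcnj_Phi[of v w] w(3) by simp
  have ml: "cnj m * l = 1" using arg_cong[OF lm, of cnj] by (simp add: mult.commute)
  define x where "x u = w \<star> (quat_j * Phi w u) + v \<star> (quat_j * Phi v u)" for u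
  have xv: "x v = w \<star> quat_j" and xw: "x w = v \<star> quat_j"
    by (simp_all add: x_def v w wv)
  have xx: "x (u + u') = x u + x u'" "x (u \<star> a) = x u \<star> a" for u u' a
    by (simp_all add: x_def Phi_simps sc_simps algebra_simps)
  have j: "quat_of_complex m * (quat_j * quat_of_complex l) = quat_j"
    "quat_of_complex l * (quat_j * quat_of_complex m) = quat_j"
    using lm ml unfolding quat_j_mult_quat_of_complex
    by (simp_all add: mult.commute flip: mult.assoc quat_of_complex_mult)
  have "reversing X x"
  proof (rule reversing_span3[where v = v and z = 0 and w = w])
    have x0: "x 0 = 0" by (simp add: x_def)
    fix b assume b: "b \<in> {v, 0, w}"
    then show "x b \<in> X \<and> x (x b) = - b \<and> g (x (g b)) = x b"
      using v w hsubspaceD(1,3)[OF X]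
      by (auto simp: xv xw x0 xx g_simps sc_simps mult.assoc j)
    fix b' assume "b' \<in> {v, 0, w}"
    with b show "Phi (x b) (x b') = Phi b b'"
      by (auto simp: xv xw x0 Phi_simps v w wv)
  qed (use X v w hsubspaceD(1)[OF X] span in \<open>auto simp: xx\<close>)
  then show ?thesis by blast
qed

text \<open>Both basis vectors are multiplied by the same \<open>q\<close>. Write
  \<open>b = L * r\<close>; nullity of \<open>g w\<close> makes \<open>r\<close> purely imaginary.
  For \<open>q = L * k\<close> the obstruction \<open>b * (q * L) + L * (q * b)\<close> becomes L (r
  k + k r), which vanishes because \<open>k\<close> conjugates \<open>r\<close> and therefore
  anticommutes with it.\<close>

lemma reversing_parabolic2:
  assumes X: "hsubspace X" and v: "v \<in> X" "Phi v v = 0" "g v = v \<star> quat_of_complex l"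
    and w: "w \<in> X" "Phi w w = 0" "Phi v w = 1" "g w = w \<star> quat_of_complex l + v \<star> b"
    and l: "cnj l * l = 1"
    and span: "\<And>u. u \<in> X \<Longrightarrow> \<exists>a b. u = v \<star> a + w \<star> b"
  shows "\<exists>x. reversing X x"
proof -
  define L M where "L = quat_of_complex l" and "M = quat_of_complex (cnj l)"
  have LM: "M * L = 1" "L * M = 1" and cL: "qcnj L = M" "qcnj M = L"
    using l by (simp_all add: L_def M_def mult.commute flip: quat_of_complex_mult)
  have wv: "Phi w v = 1" using qcnj_Phi[of v w] w(3) by simp
  define r where "r = M * b"
  have b: "b = L * r" by (simp add: r_def LM flip: mult.assoc)
  have "Phi (g w) (g w) = 0" by (simp only: Phi_g w(2))
  then have "M * b + qcnj b * L = 0"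
    by (simp add: w(4) Phi_simps v w wv cL add.commute flip: L_def)
  then have r: "qcnj r = - r"
    by (simp add: r_def qcnj_mult cL eq_neg_iff_add_eq_0 add.commute)
  obtain k where k: "k * r = qcnj r * k" "k * k = - 1" "qcnj k = - k"
    "\<And>c. k * quat_of_complex c = quat_of_complex (cnj c) * k"
    using quat_conjugating_unit[of r] by blast
  have kL: "k * L = M * k" "k * M = L * k" using k(4)[of l] k(4)[of "cnj l"] by (simp_all add: L_def M_def)
  have kr: "k * r = - (r * k)" using k(1) r by simp
  define q where "q = L * k"
  have q: "q * q = - 1" "qcnj q = - q" "L * (q * L) = q"
    and bq: "b * (q * L) + L * (q * b) = 0"
  proof -
    have a: "k * (L * x) = M * (k * x)" "k * (r * x) = - (r * (k * x))" "k * (k * x) = - x" "L * (M * x) = x" for x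
      using kL kr k(2) LM by (simp_all flip: mult.assoc)
    show "q * q = - 1" "qcnj q = - q" "L * (q * L) = q" "b * (q * L) + L * (q * b) = 0"
      by (simp_all add: q_def b qcnj_mult k(2,3) cL kL kr mult.assoc a LM)
  qed
  define x where "x u = v \<star> (q * Phi w u) + w \<star> (q * Phi v u)" for u
  have xv: "x v = v \<star> q" and xw: "x w = w \<star> q"
    by (simp_all add: x_def v w wv)
  have xx: "x (u + u') = x u + x u'" "x (u \<star> a) = x u \<star> a" for u u' a
    by (simp_all add: x_def Phi_simps sc_simps algebra_simps)
  have gv: "g v = v \<star> L" and gw: "g w = w \<star> L + v \<star> b" by (simp_all add: v w L_def)
  have "g (x (g w)) = w \<star> (L * (q * L)) + v \<star> (b * (q * L) + L * (q * b))"
    by (simp add: gv gw xv xw xx g_simps sc_simps mult.assoc)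
  then have gxgw: "g (x (g w)) = x w" by (simp add: q bq xw)
  have "reversing X x"
  proof (rule reversing_span3[where v = v and z = 0 and w = w])
    have x0: "x 0 = 0" by (simp add: x_def)
    fix b assume b: "b \<in> {v, 0, w}"
    then show "x b \<in> X \<and> x (x b) = - b \<and> g (x (g b)) = x b"
      using v(1) w(1) hsubspaceD(1,3)[OF X] gxgw
      by (auto simp: xv xw x0 xx gv g_simps sc_simps mult.assoc q)
    fix b' assume "b' \<in> {v, 0, w}"
    with b show "Phi (x b) (x b') = Phi b b'"
      by (auto simp: xv xw x0 Phi_simps v w wv q)
  qed (use X v w hsubspaceD(1)[OF X] span in \<open>auto simp: xx\<close>)
  then show ?thesis by blast
qed

text \<open>The map is diagonal in the basis \<open>v\<close>, \<open>z\<close>, \<open>w\<close>.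
  Nullity of \<open>g w\<close> gives the relation \<open>1 + L * S + M * s = 0\<close>, which is
  exactly what the last coefficient of \<open>g (x (g w))\<close> requires.\<close>

lemma reversing_parabolic3:
  assumes X: "hsubspace X" and mem: "v \<in> X" "z \<in> X" "w \<in> X"
    and gram: "Phi v v = 0" "Phi z z = 1" "Phi w w = 0" "Phi v z = 0" "Phi z w = 0" "Phi v w = 1"
    and gv: "g v = v \<star> quat_of_complex l" and gz: "g z = z \<star> quat_of_complex l + v"
    and gw: "g w = w \<star> quat_of_complex l - z \<star> quat_of_complex (l * l) + v \<star> s"
    and s: "s * quat_of_complex l = quat_of_complex l * s"
    and l: "cnj l * l = 1"
    and span: "\<And>u. u \<in> X \<Longrightarrow> \<exists>a b c. u = v \<star> a + z \<star> b + w \<star> c"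
  shows "\<exists>x. reversing X x"
proof -
  define L M S where "L = quat_of_complex l" and "M = quat_of_complex (cnj l)" and "S = qcnj s"
  have LM: "M * L = 1" "L * M = 1" and cL: "qcnj L = M" "qcnj M = L"
    using l by (simp_all add: L_def M_def mult.commute flip: quat_of_complex_mult)
  have gram': "Phi z v = 0" "Phi w z = 0" "Phi w v = 1"
    using qcnj_Phi[of v z] qcnj_Phi[of z w] qcnj_Phi[of v w] gram by simp_all
  note gr = gram gram'
  have gv: "g v = v \<star> L" and gz: "g z = z \<star> L + v" and gw: "g w = w \<star> L - z \<star> (L * L) + v \<star> s"
    using gv gz gw by (simp_all add: L_def quat_of_complex_mult)
  have LM': "L * (M * x) = x" "M * (L * x) = x" for x using LM by (simp_all flip: mult.assoc)
  have sL: "s * L = L * s" using s by (simp add: L_def)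
  have "s * M = M * (L * s) * M" by (simp add: LM')
  then have sM: "s * M = M * s" by (metis LM(2) mult.assoc mult.right_neutral sL)
  have SL: "S * L = L * S" "S * M = M * S"
    using arg_cong[OF sL, of qcnj] arg_cong[OF sM, of qcnj] by (simp_all add: S_def qcnj_mult cL)
  have "Phi (g w) (g w) = 0" by (simp add: Phi_g gr)
  then have "1 + L * S + M * s = 0"
    by (simp add: gw Phi_simps gr cL S_def[symmetric] SL qcnj_mult mult.assoc LM LM' ac_simps)
  then have Ms: "M * s = - (1 + L * S)" by (rule minus_unique[symmetric])
  obtain k where k: "k * s = S * k" "k * k = - 1" "qcnj k = - k"
    "\<And>c. k * quat_of_complex c = quat_of_complex (cnj c) * k"
    using quat_conjugating_unit[of s] unfolding S_def by blast
  have kL: "k * L = M * k" "k * M = L * k" using k(4)[of l] k(4)[of "cnj l"] by (simp_all add: L_def M_def)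
  \<comment> \<open>In \<open>g (x (g z))\<close> the vector \<open>v\<close> has coefficient
    \<open>k * L + L * p\<close>; its vanishing forces \<open>p\<close>, since
    \<open>M * k = k * L\<close>.\<close>
  define p where "p = - (k * (L * L))"
  have a: "k * (L * x) = M * (k * x)" "k * (M * x) = L * (k * x)" "k * (s * x) = S * (k * x)" "k * (k * x) = - x"
    "s * (M * x) = M * (s * x)" "s * (L * x) = L * (s * x)" "M * (s * x) = - (x + L * (S * x))" for x
    using kL k(1,2) sL sM Ms by (simp_all add: distrib_right left_diff_distrib flip: mult.assoc)
  have p: "p * p = - 1" "qcnj p = - p" "L * (p * L) = p" "L * (k * L) = k" "k * L + L * p = 0"
    "L * (L * (p * L)) + L * (k * (L * L)) = 0"
    by (simp_all add: p_def mult.assoc kL a LM LM' qcnj_mult k(2,3) cL qcnj_minus)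
  \<comment> \<open>As \<open>k\<close> conjugates \<open>s\<close> and \<open>s\<close> commutes
    with \<open>L\<close>, the left side is
    \<open>- k * (L * L) * (1 + L * S + M * s)\<close>.\<close>
  have ps: "s * (p * L) - k * (L * L) + L * (p * s) = 0"
    by (simp add: p_def mult.assoc kL a LM LM' k(1) algebra_simps)
  define x where "x u = v \<star> (p * Phi w u) + z \<star> (k * Phi z u) + w \<star> (p * Phi v u)" for u
  have xb: "x v = v \<star> p" "x z = z \<star> k" "x w = w \<star> p"
    by (simp_all add: x_def gr)
  have xx: "x (u + u') = x u + x u'" "x (u \<star> a) = x u \<star> a" "x (u - u') = x u - x u'" for u u' a
    by (simp_all add: x_def Phi_simps sc_simps algebra_simps)
  have "g (x (g z)) = z \<star> (L * (k * L)) + v \<star> (k * L + L * p)"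
    by (simp add: gv gz xb xx g_simps sc_simps mult.assoc)
  then have gxgz: "g (x (g z)) = x z" by (simp add: p xb)
  have "g (x (g w)) = w \<star> (L * (p * L)) - z \<star> (L * (L * (p * L)) + L * (k * (L * L)))
      + v \<star> (s * (p * L) - k * (L * L) + L * (p * s))"
    by (simp add: gv gz gw xb xx g_simps sc_simps mult.assoc)
  then have gxgw: "g (x (g w)) = x w" unfolding p(6) ps by (simp add: p(3) xb)
  have "reversing X x"
  proof (rule reversing_span3[where v = v and z = z and w = w])
    fix b assume b: "b \<in> {v, z, w}"
    then show "x b \<in> X \<and> x (x b) = - b \<and> g (x (g b)) = x b"
      using mem hsubspaceD(3)[OF X] gxgz gxgw
      by (auto simp: xb xx gv g_simps sc_simps mult.assoc p k(2))
    fix b' assume "b' \<in> {v, z, w}"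
    with b show "Phi (x b) (x b') = Phi b b'"
      by (auto simp: xb Phi_simps gr p k(2,3))
  qed (use X mem span in \<open>auto simp: xx\<close>)
  then show ?thesis by blast
qed

section \<open>Reduction to the explicit bases\<close>

text \<open>The vectors orthogonal to \<open>v\<close> and \<open>z\<close> are only the multiples
  of \<open>v\<close>, so a null partner of \<open>v\<close> completes a basis, and pairing with
  \<open>v\<close> and \<open>z\<close> determines its image up to a multiple of
  \<open>v\<close>.\<close>

lemma reversing_of_jordan_vector:
  assumes X: "hsubspace X" "\<And>u. u \<in> X \<Longrightarrow> g u \<in> X" "X \<subseteq> V" "cdim_le k X"
    and nondeg: "\<And>u. u \<in> X \<Longrightarrow> (\<And>w. w \<in> X \<Longrightarrow> Phi u w = 0) \<Longrightarrow> u = 0"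
    and null: "\<And>u m. u \<in> X \<Longrightarrow> g u = u \<star> quat_of_complex m \<Longrightarrow> sq u = 0"
    and v: "v \<in> X" "v \<noteq> 0" "Phi v v = 0" and z: "z \<in> X" "Phi z z = 1" "Phi v z = 0"
    and gv: "g v = v \<star> quat_of_complex l" and gz: "g z = z \<star> quat_of_complex l + v"
    and l: "cnj l * l = 1"
  shows "\<exists>x. reversing X x"
proof -
  note X' = hsubspaceD[OF X(1)]
  define L M where "L = quat_of_complex l" and "M = quat_of_complex (cnj l)"
  have LM: "M * L = 1" "L * M = 1"
    using l by (simp_all add: L_def M_def mult.commute flip: quat_of_complex_mult)
  have cancel: "a = L * b" if "M * a = b" for a b
    using that LM by (auto simp flip: mult.assoc)
  have Phi_v_g: "Phi v (g u) = L * Phi v u" for u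
    by (rule cancel) (simp add: M_def Phi_eigenvector_g[OF gv])
  have Phi_z_g: "Phi z (g u) = L * (Phi z u - L * Phi v u)" for u
  proof (rule cancel)
    have "Phi (g z) (g u) = M * Phi z (g u) + Phi v (g u)"
      by (simp add: gz Phi_simps M_def)
    then show "M * Phi z (g u) = Phi z u - L * Phi v u" by (simp add: Phi_g Phi_v_g)
  qed
  define U where "U = {u \<in> {u \<in> X. Phi v u = 0}. Phi z u = 0}"
  have U: "hsubspace U" unfolding U_def by (intro hsubspace_perp X)
  have UX: "U \<subseteq> X" by (auto simp: U_def)
  have memU: "u \<in> U \<longleftrightarrow> u \<in> X \<and> Phi v u = 0 \<and> Phi z u = 0" for u by (auto simp: U_def)
  have zv: "Phi z v = 0" using z(3) Phi_eq_0_commute by blast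
  have vU: "v \<in> U" by (simp add: memU v zv)
  have gU: "g u \<in> U" if "u \<in> U" for u
    using that X(2) by (simp add: memU Phi_v_g Phi_z_g)
  have sv: "sq v = 0" and sz: "sq z = 1" by (simp_all add: sq_def v z)
  have UV: "U \<subseteq> V" using UX X(3) by blast
  have Uk: "cdim_le k U" by (rule cdim_le_mono[OF X(4) UX])
  have U_perp: "Phi v u = 0" if "u \<in> U" for u using that by (simp add: memU)
  have U_null: "sq u = 0" if "u \<in> U" "g u = u \<star> quat_of_complex m" for u m using null that UX by blast
  txt \<open>A second Jordan vector \<open>e\<close> orthogonal to \<open>z\<close> would give the eigenvector \<open>e - z t\<close> of positive norm.\<close>
  have UQ: "U \<subseteq> range (\<lambda>a. v \<star> a)"
  proof (rule ccontr)
    assume ne: "\<not> ?thesis"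
    have "\<exists>z t. z \<in> U \<and> z \<notin> range (\<lambda>a. v \<star> a) \<and> g z = z \<star> quat_of_complex l + v \<star> t \<and>
      t * quat_of_complex l = quat_of_complex l * t"
      by (rule null_eigenvector_jordan_partner) (fact U gU UV Uk vU v U_perp gv U_null ne)+
    then obtain e t where e: "e \<in> U" "e \<notin> range (\<lambda>a. v \<star> a)" "g e = e \<star> quat_of_complex l + v \<star> t"
      "t * quat_of_complex l = quat_of_complex l * t"
      by blast
    have pos: "sq e > 0"
      using lorentz[of v e] e(1,2) v(1,2) sv X(3) UX by (force simp: memU)
    have "sq (e + z \<star> (- t)) = sq e + qnorm2 (- t) * sq z"
      using e(1) Phi_eq_0_commute[of z e] by (subst sq_add_orthogonal) (auto simp: memU Phi_simps sq_sc)
    with pos sz have "sq (e + z \<star> (- t)) > 0" using qnorm2_nonneg[of "- t"] by simp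
    moreover have "g (e + z \<star> (- t)) = (e + z \<star> (- t)) \<star> quat_of_complex l"
      by (simp add: g_simps e(3) gz sc_simps e(4) algebra_simps)
    moreover have "e + z \<star> (- t) \<in> X" using e(1) UX z(1) X' by blast
    ultimately show False using null by force
  qed
  obtain y where y: "y \<in> X" "Phi v y = 1" "Phi z y = 0" "Phi y y = 0"
    using null_partner[OF X(1) nondeg v z(1,3)] z(2) by metis
  \<comment> \<open>By \<open>Phi_v_g\<close> and \<open>Phi_z_g\<close>, \<open>g y\<close> pairs
    with \<open>v\<close> to \<open>L\<close> and with \<open>z\<close> to
    \<open>- (L * L)\<close>.\<close>
  have "g y - y \<star> L + z \<star> (L * L) \<in> U"
    using X(2)[OF y(1)] y z X' by (simp add: memU Phi_simps Phi_v_g Phi_z_g)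
  then obtain s where "g y - y \<star> L + z \<star> (L * L) = v \<star> s" using UQ by blast
  then have gy: "g y = y \<star> L - z \<star> (L * L) + v \<star> s" by (simp add: algebra_simps)
  \<comment> \<open>A partner of \<open>v\<close> may still be moved by \<open>v \<star> b\<close>
    with \<open>b\<close> imaginary; this freedom makes the last coefficient commute with
    \<open>L\<close>.\<close>
  obtain b where b: "qcnj b = - b" "(s + L * b - b * L) * L = L * (s + L * b - b * L)"
    using quat_sylvester_centralizer[of s l] unfolding L_def by blast
  define w where "w = y + v \<star> b"
  have yv: "Phi y v = 1" using qcnj_Phi[of v y] y(2) by simp
  have w: "w \<in> X" "Phi v w = 1" "Phi z w = 0" "Phi w w = 0"
    using y v zv X' by (simp_all add: w_def Phi_simps yv b)
  have gw: "g w = w \<star> L - z \<star> (L * L) + v \<star> (s + L * b - b * L)"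
    by (simp add: w_def g_simps gy gv sc_simps L_def algebra_simps)
  show ?thesis
  proof (rule reversing_parabolic3[OF X(1) v(1) z(1) w(1) v(3) z(2) w(4) z(3) w(3,2) gv gz _ _ l])
    show "g w = w \<star> quat_of_complex l - z \<star> quat_of_complex (l * l) + v \<star> (s + L * b - b * L)"
      using gw by (simp add: L_def quat_of_complex_mult)
    show "(s + L * b - b * L) * quat_of_complex l = quat_of_complex l * (s + L * b - b * L)"
      using b(2) by (simp add: L_def)
    fix u assume u: "u \<in> X"
    have "u - w \<star> Phi v u - z \<star> Phi z u \<in> U"
      using u w z X' by (simp add: memU Phi_simps)
    then obtain a where "u - w \<star> Phi v u - z \<star> Phi z u = v \<star> a" using UQ by blast
    then have "u = v \<star> a + z \<star> Phi z u + w \<star> Phi v u" by (simp add: algebra_simps)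
    then show "\<exists>a b c. u = v \<star> a + z \<star> b + w \<star> c" by blast
  qed
qed

text \<open>The complement \<open>U\<close> of \<open>v\<close> contains \<open>v\<close>. If it is
  larger than the line of \<open>v\<close>, a Jordan vector in it leads to dimension three; if not,
  \<open>X\<close> is spanned by \<open>v\<close> and a null partner.\<close>

lemma reversing_of_null_eigenvectors:
  assumes X: "hsubspace X" "\<And>u. u \<in> X \<Longrightarrow> g u \<in> X" "X \<subseteq> V" "cdim_le k X"
    and nondeg: "\<And>u. u \<in> X \<Longrightarrow> (\<And>w. w \<in> X \<Longrightarrow> Phi u w = 0) \<Longrightarrow> u = 0"
    and null: "\<And>u m. u \<in> X \<Longrightarrow> g u = u \<star> quat_of_complex m \<Longrightarrow> sq u = 0"
    and v: "v \<in> X" "v \<noteq> 0" and gv: "g v = v \<star> quat_of_complex l"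
  shows "\<exists>x. reversing X x"
proof -
  note X' = hsubspaceD[OF X(1)]
  have sv: "sq v = 0" using null v gv by blast
  then have vv: "Phi v v = 0" by (simp add: Phi_self)
  define U where "U = {u \<in> X. Phi v u = 0}"
  have memU: "u \<in> U \<longleftrightarrow> u \<in> X \<and> Phi v u = 0" for u by (auto simp: U_def)
  have U: "hsubspace U" unfolding U_def by (intro hsubspace_perp X)
  have UX: "U \<subseteq> X" by (auto simp: U_def)
  have vU: "v \<in> U" by (simp add: memU v vv)
  obtain y where y: "y \<in> X" "Phi v y = 1" "Phi y y = 0"
    using null_partner[OF X(1) nondeg v vv X'(1)] by auto
  have Phi_v_g: "quat_of_complex (cnj l) * Phi v (g u) = Phi v u" for u
    by (rule Phi_eigenvector_g[OF gv])
  have l0: "l \<noteq> 0" using Phi_v_g[of y] y(2) by auto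
  have gU: "g u \<in> U" if "u \<in> U" for u
    using that X(2) Phi_v_g[of u] l0 by (simp add: memU)
  have UV: "U \<subseteq> V" using UX X(3) by blast
  have Uk: "cdim_le k U" by (rule cdim_le_mono[OF X(4) UX])
  have U_perp: "Phi v u = 0" if "u \<in> U" for u using that by (simp add: memU)
  have U_null: "sq u = 0" if "u \<in> U" "g u = u \<star> quat_of_complex m" for u m using null that UX by blast
  show ?thesis
  proof (cases "U \<subseteq> range (\<lambda>a. v \<star> a)")
    case ne: False
    have "\<exists>z t. z \<in> U \<and> z \<notin> range (\<lambda>a. v \<star> a) \<and> g z = z \<star> quat_of_complex l + v \<star> t \<and>
      t * quat_of_complex l = quat_of_complex l * t"
      by (rule null_eigenvector_jordan_partner) (fact U gU UV Uk vU v vv U_perp gv U_null ne)+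
    then obtain z t where z: "z \<in> U" "z \<notin> range (\<lambda>a. v \<star> a)" "g z = z \<star> quat_of_complex l + v \<star> t"
      "t * quat_of_complex l = quat_of_complex l * t"
      by blast
    have pos: "sq z > 0"
      using lorentz[of v z] z(1,2) v(1,2) sv X(3) UX by (force simp: memU)
    \<comment> \<open>Otherwise \<open>z\<close> would be an eigenvector of positive square.\<close>
    have t0: "t \<noteq> 0" using z(3) null[of z l] pos z(1) UX by auto
    have zv: "Phi z v = 0" "Phi v z = 0" using z(1) Phi_eq_0_commute[of v z] by (auto simp: memU)
    have "sq (g z) = sq (z \<star> quat_of_complex l) + sq (v \<star> t)"
      unfolding z(3) by (rule sq_add_orthogonal) (simp add: Phi_simps zv)
    then have "(cmod l)\<^sup>2 * sq z = sq z"
      by (simp add: sq_g sq_sc sv qnorm2_quat_of_complex)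
    then have l: "cnj l * l = 1" using pos by (intro cnj_mult_self_eq_1I[of l "sq z"]) auto
    \<comment> \<open>\<open>c\<close> gives \<open>z\<close> square 1, and rescaling
      \<open>v\<close> by \<open>t * quat_of_complex c\<close> makes the off-diagonal coefficient 1.
      The new \<open>v\<close> keeps the eigenvalue \<open>l\<close> because \<open>t\<close>
      commutes with it.\<close>
    define c where "c = complex_of_real (1 / sqrt (sq z))"
    have c0: "c \<noteq> 0" using pos by (simp add: c_def)
    have cc: "quat_of_complex c * q = q * quat_of_complex c" for q
      unfolding c_def by (rule quat_of_real_central)
    let ?v = "v \<star> (t * quat_of_complex c)" and ?z = "z \<star> quat_of_complex c"
    have "Phi ?z ?z = quat_of_complex (cnj c * (complex_of_real (sq z) * c))"
      by (simp only: Phi_sc_left Phi_sc_right Phi_self[of z] qcnj_quat_of_complex quat_of_complex_mult mult.assoc)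
    also have "cnj c * (complex_of_real (sq z) * c) = complex_of_real (sq z / (sqrt (sq z))\<^sup>2)"
      by (simp only: c_def complex_cnj_complex_of_real of_real_mult[symmetric])
        (simp add: power2_eq_square)
    also have "sq z / (sqrt (sq z))\<^sup>2 = 1" using pos by simp
    finally have zz: "Phi ?z ?z = 1" by simp
    have tl: "quat_of_complex l * (t * quat_of_complex c) = t * quat_of_complex c * quat_of_complex l"
      by (metis cc mult.assoc z(4))
    show ?thesis
    proof (rule reversing_of_jordan_vector)
      show "?v \<in> X" "?z \<in> X" using v z(1) UX X' by blast+
      show "?v \<noteq> 0" using v t0 c0 by simp
      show "Phi ?z ?z = 1" by (rule zz)
      show "Phi ?v ?v = 0" "Phi ?v ?z = 0" by (simp_all add: Phi_simps vv zv)
      show "g ?v = ?v \<star> quat_of_complex l"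
        by (simp add: g_simps gv sc_sc tl)
      show "g ?z = ?z \<star> quat_of_complex l + ?v"
        by (simp add: g_simps z(3) sc_add_left sc_sc cc[of "quat_of_complex l"])
    qed (fact X nondeg null l)+
  next
    case UQ: True
    have span: "\<exists>a b. u = v \<star> a + w \<star> b" if "u \<in> X" "w \<in> X" "Phi v w = 1" for u w
    proof -
      have "u - w \<star> Phi v u \<in> U" using that X' by (simp add: memU Phi_simps)
      then obtain a where "u - w \<star> Phi v u = v \<star> a" using UQ by blast
      then have "u = v \<star> a + w \<star> Phi v u" by (simp add: algebra_simps)
      then show ?thesis by blast
    qed
    \<comment> \<open>\<open>g\<close> preserves the pairing with \<open>v\<close>, which forces
      this eigenvalue modulo \<open>v\<close>.\<close>
    define m where "m = inverse (cnj l)"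
    have lm: "cnj l * m = 1" using l0 by (simp add: m_def)
    have "Phi v (g y) = quat_of_complex m * (quat_of_complex (cnj l) * Phi v (g y))"
      using lm by (simp add: mult.commute flip: mult.assoc quat_of_complex_mult)
    then have "Phi v (g y) = quat_of_complex m" by (simp add: Phi_v_g y)
    then have "g y - y \<star> quat_of_complex m \<in> U"
      using X(2)[OF y(1)] y X' by (simp add: memU Phi_simps)
    then obtain b where "g y - y \<star> quat_of_complex m = v \<star> b" using UQ by blast
    then have gy: "g y = y \<star> quat_of_complex m + v \<star> b" by (simp add: algebra_simps)
    show ?thesis
    proof (cases "cmod l = 1")
      case True
      then have l: "cnj l * l = 1" by (rule cnj_mult_self_eq_1)
      then have "m = l" using lm l0 by (metis complex_cnj_zero_iff mult_cancel_left)
      with gy show ?thesis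
        using reversing_parabolic2[OF X(1) v(1) vv gv y(1,3,2) _ l] span y by blast
    next
      case False
      \<comment> \<open>The moduli are mutually inverse and different from 1, so \<open>l\<close>
        and \<open>m\<close> are not conjugate and \<open>b\<close> can be removed.\<close>
      have "cmod l * cmod m = 1" using arg_cong[OF lm, of cmod] by (simp add: norm_mult)
      with False have "cmod l \<noteq> cmod m"
        by (metis abs_norm_cancel power2_eq_1_iff power2_eq_square abs_1 abs_minus_cancel)
      then have "l \<noteq> m" "l \<noteq> cnj m" by auto
      then obtain s where s: "b + quat_of_complex l * s = s * quat_of_complex m"
        using quat_sylvester by blast
      let ?w = "y + v \<star> s"
      have "g ?w = y \<star> quat_of_complex m + v \<star> (b + quat_of_complex l * s)"
        by (simp add: g_simps gy gv sc_simps algebra_simps)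
      then have gw: "g ?w = ?w \<star> quat_of_complex m" by (simp add: s sc_simps)
      have w: "?w \<in> X" "Phi v ?w = 1" using y v X' by (simp_all add: Phi_simps vv)
      have "Phi ?w ?w = 0" using null[OF w(1) gw] by (simp add: Phi_self)
      then show ?thesis
        using reversing_hyperbolic[OF X(1) v(1) vv gv w(1) _ w(2) gw lm] span w by blast
    qed
  qed
qed

text \<open>Induction on a bound for the complex dimension. Only a nonnull eigenvector leads to a
  smaller space; when all eigenvectors are null, the map is obtained directly.\<close>

lemma reversing_exists:
  assumes "hsubspace X" "\<And>u. u \<in> X \<Longrightarrow> g u \<in> X" "X \<subseteq> V" "cdim_le k X"
    and "\<And>u. u \<in> X \<Longrightarrow> (\<And>w. w \<in> X \<Longrightarrow> Phi u w = 0) \<Longrightarrow> u = 0"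
  shows "\<exists>x. reversing X x"
  using assms
proof (induction k arbitrary: X rule: less_induct)
  case (less k)
  note X = less.prems(1-4) and nondeg = less.prems(5)
  note X' = hsubspaceD[OF X(1)]
  consider "X \<subseteq> {0}" | v l where "v \<in> X" "g v = v \<star> quat_of_complex l" "sq v \<noteq> 0"
    | "\<not> X \<subseteq> {0}" "\<And>u m. u \<in> X \<Longrightarrow> g u = u \<star> quat_of_complex m \<Longrightarrow> sq u = 0"
    by blast
  then show ?case
  proof cases
    case 1
    then have "reversing X (\<lambda>u. u)" by (auto simp: reversing_def)
    then show ?thesis by blast
  next
    case (2 v l)
    have l: "cnj l * l = 1" by (rule eigenvalue_norm_1[OF 2(2,3)])
    then have l0: "l \<noteq> 0" by auto
    have vv: "Phi v v \<noteq> 0" using 2(3) by (simp add: Phi_self)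
    define Z where "Z = {u \<in> X. Phi v u = 0}"
    have memZ: "u \<in> Z \<longleftrightarrow> u \<in> X \<and> Phi v u = 0" for u by (auto simp: Z_def)
    have Z: "hsubspace Z" "Z \<subseteq> X" unfolding Z_def by (auto intro: hsubspace_perp X)
    have gZ: "g u \<in> Z" if "u \<in> Z" for u
      using that X(2) Phi_eigenvector_g[OF 2(2), of u] l0 by (simp add: memZ)
    have "v \<notin> Z" using vv by (simp add: memZ)
    note dim = cdim_le_proper_subspace[OF X(4) Z 2(1) this]
    have "\<exists>x. reversing Z x"
    proof (rule less.IH[OF _ Z(1) gZ _ dim(2)])
      show "k - 1 < k" using dim(1) by simp
      show "Z \<subseteq> V" using Z(2) X(3) by blast
      fix u assume u: "u \<in> Z" "\<And>w. w \<in> Z \<Longrightarrow> Phi u w = 0"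
      have uv: "Phi u v = 0" using u(1) Phi_eq_0_commute by (auto simp: memZ)
      show "u = 0"
      proof (rule nondeg)
        fix w assume w: "w \<in> X"
        \<comment> \<open>Subtracting its projection to \<open>v\<close> moves \<open>w\<close> into
          \<open>Z\<close> without changing its pairing with \<open>u\<close>, so \<open>Z\<close>
          is nondegenerate again.\<close>
        have "w - v \<star> (inverse (Phi v v) * Phi v w) \<in> Z"
          using w 2(1) X' vv by (simp add: memZ Phi_simps flip: mult.assoc)
        from u(2)[OF this] show "Phi u w = 0" by (simp add: Phi_simps uv)
      qed (use u(1) Z(2) in blast)
    qed
    then obtain x where "reversing Z x" ..
    then show ?thesis
      using reversing_orthogonal_sum[OF X(1) Z 2(1) _ 2(2) l 2(3) gZ] memZ by blast
  next
    case 3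
    have "hsubspace {0}" by (simp add: hsubspace_def)
    then obtain v m where v: "v \<in> X" "v \<noteq> 0" "g v - v \<star> quat_of_complex m \<in> {0}"
      using quotient_eigenvector[OF X(1,2,4) _ 3(1)] by (metis singletonI)
    then have gv: "g v = v \<star> quat_of_complex m" by simp
    show ?thesis
      by (rule reversing_of_null_eigenvectors) (fact X nondeg 3(2) v(1,2) gv)+
  qed
qed

end


section \<open>Matrices acting on column vectors\<close>

text \<open>
  A column vector of length \<open>m\<close> is a function on \<open>nat\<close> vanishing from \<open>m\<close> on, so that
  the vectors form an abelian group type independent of \<open>m\<close>.
\<close>

definition vec_scale :: "(nat \<Rightarrow> quat) \<Rightarrow> quat \<Rightarrow> nat \<Rightarrow> quat" where
  "vec_scale u a = (\<lambda>i. u i * a)"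

definition vec_space :: "nat \<Rightarrow> (nat \<Rightarrow> quat) set" where
  "vec_space m = {u. \<forall>i\<ge>m. u i = 0}"

definition unit_vector :: "nat \<Rightarrow> nat \<Rightarrow> quat" where
  "unit_vector j = (\<lambda>i. if i = j then 1 else 0)"

definition mat_action :: "quat mat \<Rightarrow> (nat \<Rightarrow> quat) \<Rightarrow> nat \<Rightarrow> quat" where
  "mat_action A u = (\<lambda>i. if i < dim_row A then \<Sum>j<dim_col A. A $$ (i, j) * u j else 0)"

definition lorentz_sign :: "nat \<Rightarrow> quat" where
  "lorentz_sign i = (if i = 0 then - 1 else 1)"

definition lorentz_form :: "nat \<Rightarrow> (nat \<Rightarrow> quat) \<Rightarrow> (nat \<Rightarrow> quat) \<Rightarrow> quat" where
  "lorentz_form n u w = (\<Sum>i<Suc n. qcnj (u i) * (lorentz_sign i * w i))"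

lemma lorentz_sign_simps [simp]: "qcnj (lorentz_sign i) = lorentz_sign i" "lorentz_sign i \<noteq> 0"
  by (simp_all add: lorentz_sign_def qcnj_minus)

lemma lorentz_sign_central: "lorentz_sign i * a = a * lorentz_sign i"
  by (simp add: lorentz_sign_def)

text \<open>Translates between matrix identity and form in both directions: applied to one-column
  matrices it makes \<open>A\<close> an isometry, applied to the columns of the reversing matrix it
  gives back the identity with \<open>quat_J\<close>.\<close>

lemma adjoint_J_mult_index:
  assumes "M \<in> carrier_mat (n + 1) r" "N \<in> carrier_mat (n + 1) c" "j < r" "k < c"
  shows "(quat_adjoint M * quat_J n * N) $$ (j, k) = lorentz_form n (\<lambda>i. M $$ (i, j)) (\<lambda>i. N $$ (i, k))"
proof -
  have "quat_adjoint M * quat_J n * N = quat_adjoint M * (quat_J n * N)"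
    by (rule assoc_mult_mat[OF quat_adjoint_carrier[OF assms(1)] quat_J_carrier assms(2)])
  also have "quat_J n * N = mat (n + 1) c (\<lambda>(i, j). lorentz_sign i * N $$ (i, j))"
    unfolding quat_J_def lorentz_sign_def by (rule mat_diag_mult_left[OF assms(2)])
  finally show ?thesis
    using assms by (auto simp: lorentz_form_def scalar_prod_def quat_adjoint_def lessThan_atLeast0
        intro!: sum.cong)
qed

lemma lorentz_form_mat_action:
  assumes A: "A \<in> carrier_mat (n + 1) (n + 1)" "quat_adjoint A * quat_J n * A = quat_J n"
  shows "lorentz_form n (mat_action A u) (mat_action A w) = lorentz_form n u w"
proof -
  define C where "C u = mat (n + 1) 1 (\<lambda>(i, _). u i)" for u :: "nat \<Rightarrow> quat"
  have C: "C u \<in> carrier_mat (n + 1) 1" for u by (simp add: C_def)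
  have act: "C (mat_action A u) = A * C u" for u
    using A(1) by (intro eq_matI) (auto simp: C_def mat_action_def scalar_prod_def lessThan_atLeast0 intro!: sum.cong)
  have form: "lorentz_form n u w = (quat_adjoint (C u) * quat_J n * C w) $$ (0, 0)" for u w
    by (subst adjoint_J_mult_index[OF C C]) (simp_all add: lorentz_form_def C_def)
  note aC = quat_adjoint_carrier[OF C] and aA = quat_adjoint_carrier[OF A(1)]
  have "quat_adjoint (A * C u) * quat_J n * (A * C w)
      = quat_adjoint (C u) * quat_adjoint A * quat_J n * (A * C w)"
    by (simp only: quat_adjoint_mult[OF A(1) C])
  also have "\<dots> = quat_adjoint (C u) * (quat_adjoint A * quat_J n * A) * C w"
    using aC[of u] aA A(1) C[of w] quat_J_carrier[of n]
    by (smt (verit) assoc_mult_mat mult_carrier_mat)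
  also have "\<dots> = quat_adjoint (C u) * quat_J n * C w"
    by (simp only: A(2))
  finally show ?thesis by (simp only: form act)
qed

section \<open>Matrix products, unit vectors and coordinates\<close>

lemma mat_action_mult:
  assumes "A \<in> carrier_mat r m" "B \<in> carrier_mat m c"
  shows "mat_action (A * B) u = mat_action A (mat_action B u)"
proof
  fix i
  show "mat_action (A * B) u i = mat_action A (mat_action B u) i"
  proof (cases "i < r")
    case True
    have "mat_action (A * B) u i = (\<Sum>k<c. \<Sum>j<m. A $$ (i, j) * B $$ (j, k) * u k)"
      using assms True by (auto simp: mat_action_def scalar_prod_def sum_distrib_right lessThan_atLeast0 intro!: sum.cong)
    also have "\<dots> = (\<Sum>j<m. \<Sum>k<c. A $$ (i, j) * B $$ (j, k) * u k)" by (rule sum.swap)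
    also have "\<dots> = mat_action A (mat_action B u) i"
      using assms True by (auto simp: mat_action_def sum_distrib_left mult.assoc intro!: sum.cong)
    finally show ?thesis .
  qed (use assms in \<open>simp add: mat_action_def\<close>)
qed

lemma mat_action_unit_vector:
  assumes "A \<in> carrier_mat r c" "j < c"
  shows "mat_action A (unit_vector j) = (\<lambda>i. if i < r then A $$ (i, j) else 0)"
  using assms by (auto simp: mat_action_def unit_vector_def if_distrib[of "(*) _"] cong: if_cong)

lemma mat_eqI_action:
  assumes "A \<in> carrier_mat r c" "B \<in> carrier_mat r c"
    and "\<And>j. j < c \<Longrightarrow> mat_action A (unit_vector j) = mat_action B (unit_vector j)"
  shows "A = B"
proof (rule eq_matI)
  fix i j assume "i < dim_row B" "j < dim_col B"
  with assms(1,2) fun_cong[OF assms(3)[of j], of i] show "A $$ (i, j) = B $$ (i, j)"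
    by (simp add: mat_action_unit_vector[OF assms(1)] mat_action_unit_vector[OF assms(2)])
qed (use assms in auto)

lemma unit_vector_in_vec_space: "j < m \<Longrightarrow> unit_vector j \<in> vec_space m"
  by (auto simp: unit_vector_def vec_space_def)

lemma vec_space_decomp:
  assumes "u \<in> vec_space m"
  shows "u = (\<Sum>j<m. vec_scale (unit_vector j) (u j))"
proof
  fix i
  have "(\<Sum>j<m. vec_scale (unit_vector j) (u j)) i = (\<Sum>j<m. vec_scale (unit_vector j) (u j) i)"
    by (induction m) simp_all
  also have "\<dots> = (\<Sum>j<m. if i = j then u j else 0)"
    by (intro sum.cong) (auto simp: vec_scale_def unit_vector_def)
  also have "\<dots> = u i"
    using assms by (auto simp: vec_space_def)
  finally show "u i = (\<Sum>j<m. vec_scale (unit_vector j) (u j)) i" by simp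
qed

section \<open>Signature of the form\<close>

lemma qRe_lorentz_form_self:
  "qRe (lorentz_form n u u) = (\<Sum>i<n. qnorm2 (u (Suc i))) - qnorm2 (u 0)"
proof -
  have "qRe (sum f A) = (\<Sum>i\<in>A. qRe (f i))" for f and A :: "nat set"
    by (induction A rule: infinite_finite_induct) simp_all
  then show ?thesis
    unfolding lorentz_form_def sum.lessThan_Suc_shift
    by (simp add: lorentz_sign_def qcnj_mult_self quat_of_complex_def)
qed

text \<open>The form is positive definite where the zeroth coordinate vanishes; the Lorentzian
  condition is derived from this.\<close>

lemma vec_space_eq_0I:
  assumes "u \<in> vec_space (Suc n)" "u 0 = 0" "qRe (lorentz_form n u u) \<le> 0"
  shows "u = 0"
proof
  fix i
  have "qnorm2 (u 0) = 0" using assms(2) by simp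
  then have "(\<Sum>i<n. qnorm2 (u (Suc i))) = 0"
    using assms(3) sum_nonneg[of "{..<n}" "\<lambda>i. qnorm2 (u (Suc i))", OF qnorm2_nonneg]
    unfolding qRe_lorentz_form_self by linarith
  then have "u (Suc j) = 0" if "j < n" for j
    using that by (simp add: sum_nonneg_eq_0_iff qnorm2_nonneg)
  with assms(1,2) show "u i = 0 i"
    unfolding vec_space_def by (cases i) (simp_all, metis not_less not_less_eq_eq)
qed

lemma mat_action_add: "mat_action A (u + w) = mat_action A u + mat_action A w"
  by (auto simp: mat_action_def fun_eq_iff algebra_simps sum.distrib)

lemma mat_action_scale: "mat_action A (vec_scale u a) = vec_scale (mat_action A u) a"
  by (auto simp: mat_action_def vec_scale_def fun_eq_iff sum_distrib_right mult.assoc)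

lemma mat_action_0: "mat_action A 0 = 0"
  by (auto simp: mat_action_def fun_eq_iff)

lemma quat_isometry_mat_action:
  assumes "A \<in> carrier_mat (n + 1) (n + 1)" "quat_adjoint A * quat_J n * A = quat_J n"
  shows "quat_isometry vec_scale (lorentz_form n) (mat_action A)"
proof
  fix u w w' :: "nat \<Rightarrow> quat" and a b :: quat
  show "vec_scale (u + w) a = vec_scale u a + vec_scale w a"
    "vec_scale u (a + b) = vec_scale u a + vec_scale u b"
    "vec_scale (vec_scale u a) b = vec_scale u (a * b)"
    "vec_scale u 1 = u"
    by (auto simp: vec_scale_def algebra_simps fun_eq_iff)
  show "lorentz_form n u (w + w') = lorentz_form n u w + lorentz_form n u w'"
    by (simp add: lorentz_form_def algebra_simps sum.distrib del: sum.lessThan_Suc)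
  show "lorentz_form n u (vec_scale w a) = lorentz_form n u w * a"
    by (simp add: lorentz_form_def vec_scale_def sum_distrib_right mult.assoc del: sum.lessThan_Suc)
  show "qcnj (lorentz_form n u w) = lorentz_form n w u"
    by (simp add: lorentz_form_def qcnj_sum qcnj_mult mult.assoc lorentz_sign_central del: sum.lessThan_Suc)
  show "lorentz_form n (mat_action A u) (mat_action A w) = lorentz_form n u w"
    by (rule lorentz_form_mat_action[OF assms])
qed (rule mat_action_add mat_action_scale)+

text \<open>
  Reverse Cauchy--Schwarz: subtracting the multiple of \<open>u\<close> that cancels the zeroth coordinate of
  \<open>w\<close> leaves a vector that is both positive and nonpositive.
\<close>

lemma lorentz_isometry_mat_action:
  assumes "A \<in> carrier_mat (n + 1) (n + 1)" "quat_adjoint A * quat_J n * A = quat_J n"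
  shows "lorentz_isometry vec_scale (lorentz_form n) (mat_action A) (vec_space (Suc n))"
proof -
  interpret quat_isometry vec_scale "lorentz_form n" "mat_action A"
    by (rule quat_isometry_mat_action[OF assms])
  show ?thesis
  proof
    fix u w
    assume u: "u \<in> vec_space (Suc n)" "u \<noteq> 0" "sq u \<le> 0" and w: "w \<in> vec_space (Suc n)" "sq w \<le> 0"
      and uw: "lorentz_form n u w = 0"
    have u0: "u 0 \<noteq> 0" using vec_space_eq_0I[OF u(1)] u(2,3) by (auto simp: sq_def)
    define q where "q = inverse (u 0) * w 0"
    let ?y = "w + vec_scale u (- q)"
    have "lorentz_form n w u = 0" using uw Phi_eq_0_commute by blast
    then have "sq ?y = sq w + qnorm2 (- q) * sq u"
      by (subst sq_add_orthogonal) (simp_all add: Phi_simps sq_sc)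
    also have "\<dots> \<le> 0"
      using w(2) mult_nonneg_nonpos[OF qnorm2_nonneg u(3)] by (simp add: add_nonpos_nonpos)
    finally have "sq ?y \<le> 0" .
    moreover have "?y \<in> vec_space (Suc n)" using u(1) w(1) by (simp add: vec_space_def vec_scale_def)
    moreover have "?y 0 = 0" using u0 by (simp add: vec_scale_def q_def flip: mult.assoc)
    ultimately have "?y = 0" using vec_space_eq_0I by (simp add: sq_def)
    then have "w = vec_scale u q" by (simp add: sc_minus_right)
    then show "w \<in> range (vec_scale u)" by blast
  qed
qed

section \<open>From the reversing map back to a matrix\<close>

lemma reversing_matrix_exists:
  assumes A: "A \<in> carrier_mat (n + 1) (n + 1)" "quat_adjoint A * quat_J n * A = quat_J n"
  shows "\<exists>X\<in>carrier_mat (n + 1) (n + 1). quat_adjoint X * quat_J n * X = quat_J n \<and>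
    X * X = - 1\<^sub>m (n + 1) \<and> A * (X * A) = X"
proof -
  let ?m = "Suc n" and ?V = "vec_space (Suc n)" and ?g = "mat_action A"
  interpret lorentz_isometry vec_scale "lorentz_form n" ?g ?V
    by (rule lorentz_isometry_mat_action[OF A])
  have V: "hsubspace ?V" by (auto simp: hsubspace_def vec_space_def vec_scale_def)
  note V' = hsubspaceD[OF V]
  have actV: "mat_action M u \<in> ?V" if "M \<in> carrier_mat (n + 1) (n + 1)" for M u
    using that by (auto simp: mat_action_def vec_space_def)
  note eV = unit_vector_in_vec_space[of _ ?m]
  \<comment> \<open>A finite complex spanning set: each coordinate line over H is spanned over C by
    two vectors.\<close>
  define B where "B = (\<Union>j<?m. {unit_vector j, vec_scale (unit_vector j) quat_j})"
  have "?V \<subseteq> cs.span B"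
  proof
    fix u assume "u \<in> ?V"
    then have "u = (\<Sum>j<?m. vec_scale (unit_vector j) (u j))" by (rule vec_space_decomp)
    moreover have "(\<Sum>j<?m. vec_scale (unit_vector j) (u j)) \<in> cs.span B"
    proof (rule cs.span_sum)
      fix j assume "j \<in> {..<?m}"
      then have "cs.span {unit_vector j, vec_scale (unit_vector j) quat_j} \<subseteq> cs.span B"
        unfolding B_def by (intro cs.span_mono) blast
      then show "vec_scale (unit_vector j) (u j) \<in> cs.span B" using sc_in_span by blast
    qed
    ultimately show "u \<in> cs.span B" by simp
  qed
  moreover have "finite B" by (simp add: B_def)
  ultimately have dim: "cdim_le (card B) ?V" by (intro cdim_le_span)
  have nondeg: "u = 0" if u: "u \<in> ?V" and perp: "\<And>w. w \<in> ?V \<Longrightarrow> lorentz_form n u w = 0" for u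
  proof
    fix i
    show "u i = 0 i"
    proof (cases "i < ?m")
      case True
      have "lorentz_form n u (unit_vector i) = (\<Sum>j<?m. if j = i then qcnj (u i) * lorentz_sign i else 0)"
        unfolding lorentz_form_def by (intro sum.cong) (auto simp: unit_vector_def)
      also have "\<dots> = qcnj (u i) * lorentz_sign i" using True by (simp del: sum.lessThan_Suc)
      finally show ?thesis using perp[OF eV[OF True]] by simp
    qed (use u in \<open>simp add: vec_space_def\<close>)
  qed
  obtain x where x: "reversing ?V x"
    using reversing_exists[OF V actV[OF A(1)] subset_refl dim nondeg] by blast
  have x_add: "x (u + w) = x u + x w" and x_iso: "lorentz_form n (x u) (x w) = lorentz_form n u w"
    if "u \<in> ?V" "w \<in> ?V" for u w using x that by (auto simp: reversing_def)
  have xV: "x u \<in> ?V" and xx: "x (x u) = - u" and gxg: "?g (x (?g u)) = x u"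
    and x_sc: "x (vec_scale u a) = vec_scale (x u) a" if "u \<in> ?V" for u a
    using x that by (auto simp: reversing_def)
  have x0: "x 0 = 0" using x_sc[OF V'(1), of 0] by simp
  \<comment> \<open>Membership of the sum is carried along because \<open>x\<close> is known to be
    additive only on \<open>?V\<close>.\<close>
  have x_sum: "x (sum f I) = (\<Sum>i\<in>I. x (f i)) \<and> sum f I \<in> ?V"
    if "\<And>i. i \<in> I \<Longrightarrow> f i \<in> ?V" for f and I :: "nat set"
    using that by (induction I rule: infinite_finite_induct) (simp_all add: x0 x_add V')
  define X where "X = mat (n + 1) (n + 1) (\<lambda>(i, j). x (unit_vector j) i)"
  have X: "X \<in> carrier_mat (n + 1) (n + 1)" by (simp add: X_def)
  have Xe: "mat_action X (unit_vector j) = x (unit_vector j)" if "j < ?m" for j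
    using that xV[OF eV[OF that]]
    by (subst mat_action_unit_vector[OF X]) (auto simp: X_def vec_space_def fun_eq_iff)
  have act_X_sum: "mat_action X (sum f I) = (\<Sum>i\<in>I. mat_action X (f i))" for f and I :: "nat set"
    by (induction I rule: infinite_finite_induct) (simp_all only: sum.infinite sum.empty sum.insert not_False_eq_True mat_action_0 mat_action_add)
  have act_X: "mat_action X u = x u" if u: "u \<in> ?V" for u
  proof -
    have "mat_action X u = (\<Sum>j<?m. vec_scale (mat_action X (unit_vector j)) (u j))"
      by (subst (1) vec_space_decomp[OF u]) (simp only: act_X_sum mat_action_scale)
    also have "\<dots> = (\<Sum>j<?m. x (vec_scale (unit_vector j) (u j)))"
      by (intro sum.cong) (simp_all add: Xe x_sc eV)
    also have "\<dots> = x (\<Sum>j<?m. vec_scale (unit_vector j) (u j))"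
      using x_sum[of "{..<?m}" "\<lambda>j. vec_scale (unit_vector j) (u j)"] V'(3) eV by simp
    also have "\<dots> = x u" using vec_space_decomp[OF u] by simp
    finally show ?thesis .
  qed
  have "A * (X * A) = X"
  proof (rule mat_eqI_action)
    fix j assume "j < n + 1"
    then have "unit_vector j \<in> ?V" using eV by simp
    then show "mat_action (A * (X * A)) (unit_vector j) = mat_action X (unit_vector j)"
      by (simp only: mat_action_mult[OF A(1) mult_carrier_mat[OF X A(1)]] mat_action_mult[OF X A(1)]
          act_X[OF actV[OF A(1)]] act_X gxg)
  qed (use A(1) X in auto)
  moreover have "X * X = - 1\<^sub>m (n + 1)"
  proof (rule mat_eqI_action)
    fix j assume j: "j < n + 1"
    then have e: "unit_vector j \<in> ?V" using eV by simp
    have "mat_action (X * X) (unit_vector j) = - unit_vector j"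
      by (simp only: mat_action_mult[OF X X] act_X[OF e] act_X[OF xV[OF e]] xx[OF e])
    also have "\<dots> = mat_action (- 1\<^sub>m (n + 1)) (unit_vector j)"
      using j by (subst mat_action_unit_vector[where r = "n + 1" and c = "n + 1"])
        (auto simp: unit_vector_def fun_eq_iff)
    finally show "mat_action (X * X) (unit_vector j) = mat_action (- 1\<^sub>m (n + 1)) (unit_vector j)" .
  qed (use X in auto)
  moreover have "quat_adjoint X * quat_J n * X = quat_J n"
  proof (rule eq_matI)
    fix i j assume "i < dim_row (quat_J n)" "j < dim_col (quat_J n)"
    then have ij: "i < n + 1" "j < n + 1" by (simp_all add: quat_J_def mat_diag_def)
    have "(quat_adjoint X * quat_J n * X) $$ (i, j)
        = lorentz_form n (\<lambda>k. X $$ (k, i)) (\<lambda>k. X $$ (k, j))"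
      by (rule adjoint_J_mult_index[OF X X ij])
    also have "\<dots> = lorentz_form n (x (unit_vector i)) (x (unit_vector j))"
      unfolding lorentz_form_def using ij by (intro sum.cong) (auto simp: X_def)
    also have "\<dots> = lorentz_form n (unit_vector i) (unit_vector j)"
      using ij eV by (intro x_iso) auto
    also have "\<dots> = (\<Sum>k<?m. if k = i then (if i = j then lorentz_sign i else 0) else 0)"
      unfolding lorentz_form_def by (intro sum.cong) (auto simp: unit_vector_def)
    also have "\<dots> = quat_J n $$ (i, j)"
      using ij by (auto simp: quat_J_def mat_diag_def lorentz_sign_def simp del: sum.lessThan_Suc)
    finally show "(quat_adjoint X * quat_J n * X) $$ (i, j) = quat_J n $$ (i, j)" .
  qed (use X in \<open>auto simp: quat_adjoint_def quat_J_def mat_diag_def\<close>)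
  ultimately show ?thesis using X by blast
qed

theorem theorem1p1:
  fixes n :: nat and g :: "quat mat"
  assumes "n \<ge> 1" and "g \<in> carrier (Sp_n_1 n)"
  shows "reversible (Sp_n_1 n) g"
proof -
  interpret group "Sp_n_1 n" by (rule group_Sp_n_1)
  have mult: "a \<otimes>\<^bsub>Sp_n_1 n\<^esub> b = a * b" for a b
    by (simp add: Sp_n_1_def)
  have carrier: "a \<in> carrier (Sp_n_1 n) \<longleftrightarrow>
      a \<in> carrier (GL_quat (n + 1)) \<and> quat_adjoint a * quat_J n * a = quat_J n" for a
    by (simp add: Sp_n_1_def)
  from assms(2) have g: "g \<in> carrier_mat (n + 1) (n + 1)" "quat_adjoint g * quat_J n * g = quat_J n"
    unfolding carrier carrier_GL_quat by auto
  obtain x where x: "x \<in> carrier_mat (n + 1) (n + 1)" "quat_adjoint x * quat_J n * x = quat_J n"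
    "x * x = - 1\<^sub>m (n + 1)" "g * (x * g) = x"
    using reversing_matrix_exists[OF g] by blast
  \<comment> \<open>The square of \<open>x\<close> supplies the two-sided inverse required in the
    general linear group.\<close>
  have "- x \<in> carrier_mat (n + 1) (n + 1)" "- x * x = 1\<^sub>m (n + 1)" "x * - x = 1\<^sub>m (n + 1)"
    using x(1,3) by simp_all
  with x(1,2) have xS: "x \<in> carrier (Sp_n_1 n)"
    unfolding carrier carrier_GL_quat by blast
  \<comment> \<open>This is \<open>g * (x * g) = x\<close> with \<open>g\<close> moved to the other
    side.\<close>
  have "x \<otimes>\<^bsub>Sp_n_1 n\<^esub> g = inv\<^bsub>Sp_n_1 n\<^esub> g \<otimes>\<^bsub>Sp_n_1 n\<^esub> x"
    using x(4) xS assms(2) by (metis mult inv_solve_left m_closed)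
  then have "inv\<^bsub>Sp_n_1 n\<^esub> g = x \<otimes>\<^bsub>Sp_n_1 n\<^esub> g \<otimes>\<^bsub>Sp_n_1 n\<^esub> inv\<^bsub>Sp_n_1 n\<^esub> x"
    using xS assms(2) by (simp add: m_assoc)
  with xS show ?thesis unfolding reversible_def by blast
qed

end
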